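(* Let $m\ge 1$, $t^0,s^0\in\mathbb{R}$, $\widetilde\eta>0$, $\mu\in\mathbb{R}$, $h=2\widetilde\eta$. Let $f:\mathbb{R}\times\mathbb{R}^m\times\mathbb{R}^m\to\mathbb{R}^m$ and $G:\mathbb{R}^m\to\mathbb{R}$ be Lipschitz, with $$|G(y)|\le \mu\widetilde\eta<\tfrac12\qquad\text{for all } y\in\mathbb{R}^m .$$ Let $(\bar g,\bar\eta^0)$ and $(g^n,\eta^{0,n})$, $n\in\mathbb{N}$, be elements of $C^1([t^0-h,t^0];\mathbb{R}^m)\times(0,2\widetilde\eta]$ with $$\|(g^n,\eta^{0,n})-(\bar g,\bar\eta^0)\|_{C^1([t^0-h,t^0];\mathbb{R}^m)\times\mathbb{R}}\to 0\quad (n\to\infty).$$ Let $\bar\omega$ be an admissible initial time function for $\bar\eta^0$ and, for each $n$, let $\omega^n$ be an admissible initial time function for $\eta^{0,n}$, with $\|\omega^n-\bar\omega\|_{C^1[s^0-h,s^0]}\to0$ as $n\to\infty$. Then the time transformation gives corresponding solutions $(z^n,\chi^n,\alpha^n)$ (for the data $(g^n,\eta^{0,n},\omega^n)$) and $(\bar z,\bar\chi,\bar\alpha)$ (for the data $(\bar g,\bar\eta^0,\bar\omega)$) of the constant delay system, and for every $S>0$ $$\max_{s\in[s^0,s^0+S]}\Big\{\|z^n(s)-\bar z(s)\|+|\chi^n(s)-\bar\chi(s)|+|\alpha^n(s)-\bar\alpha(s)|\Big\}\to0\quad\text{as } n\to\infty,$$ and $\dot\alpha^n(s)>0$ for $s\in[s^0,s^0+S]$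 and every $n$ (at the points $s^0+kh$, $k=0,1,2,\dots$, both one-sided derivatives are positive).
   Context: State-dependent delay system. For $(g,\eta^0)$ consider $$\dot y(t)=f(t,y(t),y(t-\eta(t))),\qquad \dot\eta(t)=-\mu(\eta(t)-\widetilde\eta)+G(y(t)),\qquad t>t^0,$$ with $y(t)=g(t)$ for $t\in[t^0-h,t^0]$ and $\eta(t^0)=\eta^0$, where $y(t)\in\mathbb{R}^m$, $\eta(t)\in\mathbb{R}$. A global solution is a pair of continuous functions $y:[t^0-h,\infty)\to\mathbb{R}^m$, $\eta:[t^0,\infty)\to\mathbb{R}$, satisfying the initial conditions, such that $y|_{[t^0,\infty)}$ and $\eta$ are $C^1$ (one-sided derivative at $t^0$) and satisfy the equations. Under the hypotheses $f,G$ Lipschitz and $|G|\le\mu\widetilde\eta$, for $g\in C^1$ and $\eta^0\in[0,2\widetilde\eta]$ there is a unique global solution, and $\eta(t)\in[0,2\widetilde\eta]$ for all $t\ge t^0$. Deviating argument: $\sigma(t)=t-\eta(t)$, $t\ge t^0$. Admissible initial time function for $\eta^0$: a $C^1$ function $\omega:[s^0-h,s^0]\to\mathbb{R}$ with $\dot\omega>0$, $\omega(s^0)=t^0$ and $\omega(s^0-h)=t^0-\eta^0<t^0$ (so $\eta^0>0$). Time transformation. If $\dot\sigma>0$ on $[t^0,\infty)$, the time transformation $\alpha:[s^0-h,\infty)\to\mathbb{R}$ associated with the solution $(y,\eta)$ and $\omega$ is defined by $\alpha(s)=\omega(s)$ on $[s^0-h,s^0]$ and, step by step on intervals of length $h$,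 $\alpha(s)=\sigma^{-1}(\alpha(s-h))$ for $s\ge s^0$. The corresponding transformed functions are $z(s)=y(\alpha(s))$ for $s\ge s^0-h$ and $\chi(s)=\eta(\alpha(s))$ for $s\ge s^0$. Constant delay system for $(z,\chi,\alpha)$ with data $(g,\eta^0,\omega)$: $$\dot z(s)=f(\alpha(s),z(s),z(s-h))\,\dot\alpha(s),\quad \dot\chi(s)=-\mu(\chi(s)-\widetilde\eta)\,\dot\alpha(s)+G(z(s))\,\dot\alpha(s),\quad \alpha(s)-\chi(s)=\alpha(s-h),\quad s\ge s^0,$$ $$z(s)=g(\omega(s)),\quad \alpha(s)=\omega(s)\quad (s\in[s^0-h,s^0]),\qquad \chi(s^0)=\eta^0 .$$ Derivatives at the points $s^0+kh$, $k=0,1,2,\dots$, are understood as one-sided derivatives ($\alpha$ is continuous and piecewise $C^1$). *)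

theory Defs
  imports "HOL-Analysis.Analysis"
begin

text \<open>Functions on an interval are total functions of which only the values on that interval
  matter; derivatives are taken within the interval, so they are one-sided at its endpoints.\<close>

definition C1_on :: "real set \<Rightarrow> (real \<Rightarrow> 'a::real_normed_vector) \<Rightarrow> bool" where
  "C1_on I u \<longleftrightarrow> (\<exists>u'. continuous_on I u' \<and>
     (\<forall>t\<in>I. (u has_vector_derivative u' t) (at t within I)))"

definition C1_norm :: "real \<Rightarrow> real \<Rightarrow> (real \<Rightarrow> 'a::real_normed_vector) \<Rightarrow> real" where
  "C1_norm a b u = (SUP t\<in>{a..b}. norm (u t)) +
     (SUP t\<in>{a..b}. norm (vector_derivative u (at t within {a..b})))"

text \<open>The bound \<open>t0 - h \<le> t - \<eta> t\<close> says that the deviating argument stays in the domain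
  \<open>{t0 - h..}\<close> of \<open>y\<close>; without it the equation would refer to values of the total function
  \<open>y\<close> outside its domain.\<close>

definition global_solution ::
  "(real \<times> (real^'m) \<times> (real^'m) \<Rightarrow> real^'m) \<Rightarrow> (real^'m \<Rightarrow> real) \<Rightarrow> real \<Rightarrow> real \<Rightarrow> real \<Rightarrow> real
    \<Rightarrow> (real \<Rightarrow> real^'m) \<Rightarrow> real \<Rightarrow> (real \<Rightarrow> real^'m) \<Rightarrow> (real \<Rightarrow> real) \<Rightarrow> bool" where
  "global_solution f G \<mu> etat h t0 g \<eta>0 y \<eta> \<longleftrightarrow>
     continuous_on {t0 - h..} y \<and> continuous_on {t0..} \<eta> \<and>
     (\<forall>t\<in>{t0 - h..t0}. y t = g t) \<and> \<eta> t0 = \<eta>0 \<and>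
     C1_on {t0..} y \<and> C1_on {t0..} \<eta> \<and>
     (\<forall>t>t0. t0 - h \<le> t - \<eta> t \<and>
        (y has_vector_derivative f (t, y t, y (t - \<eta> t))) (at t) \<and>
        (\<eta> has_real_derivative - \<mu> * (\<eta> t - etat) + G (y t)) (at t))"

definition admissible_initial_time :: "real \<Rightarrow> real \<Rightarrow> real \<Rightarrow> real \<Rightarrow> (real \<Rightarrow> real) \<Rightarrow> bool" where
  "admissible_initial_time t0 s0 h \<eta>0 \<omega> \<longleftrightarrow>
     C1_on {s0 - h..s0} \<omega> \<and>
     (\<forall>s\<in>{s0 - h..s0}. \<exists>d>0. (\<omega> has_real_derivative d) (at s within {s0 - h..s0})) \<and>
     \<omega> s0 = t0 \<and> \<omega> (s0 - h) = t0 - \<eta>0 \<and> t0 - \<eta>0 < t0"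

text \<open>The first conjunct is the precondition \<open>\<sigma>' > 0\<close> on \<open>{t0..}\<close>, where
  \<open>\<sigma> t = t - \<eta> t\<close>; the last one is \<open>\<alpha> s = \<sigma>\<^sup>-\<^sup>1 (\<alpha> (s - h))\<close>, including
  that \<open>\<alpha> (s - h)\<close> lies in the range of \<open>\<sigma>\<close>.\<close>

definition time_transformation ::
  "real \<Rightarrow> real \<Rightarrow> real \<Rightarrow> (real \<Rightarrow> real) \<Rightarrow> (real \<Rightarrow> real) \<Rightarrow> (real \<Rightarrow> real) \<Rightarrow> bool" where
  "time_transformation t0 s0 h \<eta> \<omega> \<alpha> \<longleftrightarrow>
     (let \<sigma> = (\<lambda>t. t - \<eta> t) in
        (\<forall>t\<ge>t0. \<exists>d>0. (\<sigma> has_real_derivative d) (at t within {t0..})) \<and>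
        (\<forall>s\<in>{s0 - h..s0}. \<alpha> s = \<omega> s) \<and>
        (\<forall>s\<ge>s0. \<alpha> (s - h) \<in> \<sigma> ` {t0..} \<and> \<alpha> s = the_inv_into {t0..} \<sigma> (\<alpha> (s - h))))"

definition transformed_solution ::
  "(real \<times> (real^'m) \<times> (real^'m) \<Rightarrow> real^'m) \<Rightarrow> (real^'m \<Rightarrow> real) \<Rightarrow> real \<Rightarrow> real \<Rightarrow> real \<Rightarrow> real \<Rightarrow> real
    \<Rightarrow> (real \<Rightarrow> real^'m) \<Rightarrow> real \<Rightarrow> (real \<Rightarrow> real)
    \<Rightarrow> (real \<Rightarrow> real^'m) \<Rightarrow> (real \<Rightarrow> real) \<Rightarrow> (real \<Rightarrow> real) \<Rightarrow> bool" where
  "transformed_solution f G \<mu> etat h t0 s0 g \<eta>0 \<omega> z chi \<alpha> \<longleftrightarrow>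
     (\<exists>y \<eta>. global_solution f G \<mu> etat h t0 g \<eta>0 y \<eta> \<and>
        time_transformation t0 s0 h \<eta> \<omega> \<alpha> \<and>
        (\<forall>s\<ge>s0 - h. z s = y (\<alpha> s)) \<and> (\<forall>s\<ge>s0. chi s = \<eta> (\<alpha> s)))"

text \<open>Requiring the differential equations on each interval \<open>{s0 + k * h..s0 + (k + 1) * h}\<close>,
  with derivatives within that interval, gives the one-sided equations at the points
  \<open>s0 + k * h\<close> (only from the right for \<open>k = 0\<close>) and the two-sided ones elsewhere.\<close>

definition constant_delay_solution ::
  "(real \<times> (real^'m) \<times> (real^'m) \<Rightarrow> real^'m) \<Rightarrow> (real^'m \<Rightarrow> real) \<Rightarrow> real \<Rightarrow> real \<Rightarrow> real \<Rightarrow> real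
    \<Rightarrow> (real \<Rightarrow> real^'m) \<Rightarrow> real \<Rightarrow> (real \<Rightarrow> real)
    \<Rightarrow> (real \<Rightarrow> real^'m) \<Rightarrow> (real \<Rightarrow> real) \<Rightarrow> (real \<Rightarrow> real) \<Rightarrow> bool" where
  "constant_delay_solution f G \<mu> etat h s0 g \<eta>0 \<omega> z chi \<alpha> \<longleftrightarrow>
     continuous_on {s0 - h..} z \<and> continuous_on {s0..} chi \<and> continuous_on {s0 - h..} \<alpha> \<and>
     (\<forall>s\<in>{s0 - h..s0}. z s = g (\<omega> s) \<and> \<alpha> s = \<omega> s) \<and> chi s0 = \<eta>0 \<and>
     (\<forall>s\<ge>s0. \<alpha> s - chi s = \<alpha> (s - h)) \<and>
     (\<forall>k::nat. let I = {s0 + real k * h..s0 + (real k + 1) * h} in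
        \<exists>\<alpha>'. continuous_on I \<alpha>' \<and>
          (\<forall>s\<in>I. (\<alpha> has_real_derivative \<alpha>' s) (at s within I) \<and>
             (z has_vector_derivative \<alpha>' s *\<^sub>R f (\<alpha> s, z s, z (s - h))) (at s within I) \<and>
             (chi has_real_derivative - \<mu> * (chi s - etat) * \<alpha>' s + G (z s) * \<alpha>' s)
               (at s within I)))"

text \<open>At the points \<open>s0 + k * h\<close>, where the function may have a kink, both one-sided derivatives
  are required to exist and to be positive.\<close>

definition positive_derivative_at :: "real \<Rightarrow> real \<Rightarrow> (real \<Rightarrow> real) \<Rightarrow> real \<Rightarrow> bool" where
  "positive_derivative_at s0 h \<alpha> s \<longleftrightarrow>
     (if \<exists>k::nat. s = s0 + real k * h
      then (\<exists>d>0. (\<alpha> has_real_derivative d) (at_left s)) \<and>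
           (\<exists>d>0. (\<alpha> has_real_derivative d) (at_right s))
      else (\<exists>d>0. (\<alpha> has_real_derivative d) (at s)))"

end

theory Submission
  imports Defs
begin

text \<open>Global solutions are obtained by Picard iteration: all iterates share a Lipschitz constant in
  \<open>y\<close> on each bounded interval, so that in an exponentially weighted sup norm a Picard step halves
  distances. The same estimate, applied to two solutions, gives continuous dependence on the data.
  Since \<open>\<eta>\<close> stays in \<open>[0, h]\<close>, the derivative of \<open>\<sigma> t = t - \<eta> t\<close> is at least
  \<open>c = 1 - 2 * \<mu> * etat > 0\<close>; hence \<open>\<sigma>\<^sup>-\<^sup>1\<close> is \<open>1/c\<close>-Lipschitz, and in each step of length \<open>h\<close>
  the error of \<open>\<alpha>\<close> grows at most by the factor \<open>2/c\<close>.\<close>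

subsection \<open>Functions with bounded derivative\<close>

text \<open>The obstacle is that the unknown occurs in the argument of the unknown: as a function of
  \<open>(y, \<eta>)\<close>, the value \<open>y (t - \<eta> t)\<close> is Lipschitz in the sup norm
  only where \<open>y\<close> itself is Lipschitz. This dictates the order of the constants. A
  growth estimate with its own exponential weight, free of any Lipschitz constant of the iterates,
  first bounds all iterates on a bounded interval and with them their derivatives; this yields
  \<open>M\<close>, and only then can the weight \<open>rate M\<close> of the contraction be fixed.
  In comparing two solutions the Lipschitz constant of one of them suffices; taking it from the
  limit solution makes the estimate uniform in \<open>n\<close>. The bound on \<open>G\<close> works
  twice. Against the restoring term \<open>- \<mu> * (\<eta> t - etat)\<close> it makes
  \<open>0\<close> and \<open>h\<close> barriers for the delay, and it gives the lower bound
  \<open>c\<close> of the derivative of \<sigma>; the condition \<open>\<mu> * etat < 1/2\<close>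
  says precisely that \<open>c > 0\<close>. Since
  \<open>chi s = \<alpha> s - \<alpha> (s - h)\<close>, the error of \<open>chi\<close> is
  controlled by two errors of \<alpha>.\<close>

lemma le_mult_exp:
  fixes c x :: real
  assumes "0 \<le> c" "0 \<le> x"
  shows "c \<le> c * exp x"
  using mult_left_mono[of 1 "exp x" c] assms by simp

text \<open>The majorant is a primitive of the bound on \<open>u'\<close>; dropping its value at
  \<open>a\<close> leaves the same exponential divided by \<open>K\<close>. This factor
  \<open>1 / K\<close> is what a large weight gains in the contraction.\<close>

lemma derivative_exp_bound:
  fixes u :: "real \<Rightarrow> 'a::real_normed_vector"
  assumes "a \<le> b" "continuous_on {a..b} u"
    and d: "\<And>t. a < t \<Longrightarrow> t < b \<Longrightarrow> (u has_vector_derivative u' t) (at t)"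
    and bd: "\<And>t. a < t \<Longrightarrow> t < b \<Longrightarrow> norm (u' t) \<le> C * exp (K * (t - a))"
    and "C \<ge> 0" "K > 0"
  shows "norm (u b - u a) \<le> C / K * exp (K * (b - a))"
proof (cases "a = b")
  case False
  let ?\<phi> = "\<lambda>t. C / K * exp (K * (t - a))"
  have "norm (u b - u a) \<le> ?\<phi> b - ?\<phi> a"
  proof (rule differentiable_bound_general[OF _ assms(2) _ d _ bd])
    show "a < b" using False assms by simp
    show "continuous_on {a..b} ?\<phi>" by (intro continuous_intros)
    show "(?\<phi> has_vector_derivative C * exp (K * (t - a))) (at t)" for t
      using \<open>K > 0\<close> unfolding has_real_derivative_iff_has_vector_derivative[symmetric]
      by (auto intro!: derivative_eq_intros simp: field_simps)
  qed auto
  moreover have "0 \<le> ?\<phi> a" using assms by simp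
  ultimately show ?thesis by linarith
qed (use assms in auto)

lemma derivative_bound_lipschitz:
  fixes u :: "real \<Rightarrow> 'a::real_normed_vector"
  assumes c: "continuous_on {a..b} u"
    and d: "\<And>t. a < t \<Longrightarrow> t < b \<Longrightarrow> (u has_vector_derivative u' t) (at t)"
    and bd: "\<And>t. a < t \<Longrightarrow> t < b \<Longrightarrow> norm (u' t) \<le> M" and "M \<ge> 0"
  shows "M-lipschitz_on {a..b} u"
proof (rule lipschitz_on_leI)
  fix x y assume xy: "x \<in> {a..b}" "y \<in> {a..b}" "x \<le> y"
  show "dist (u x) (u y) \<le> M * dist x y"
  proof (cases "x = y")
    case False
    have "norm (u y - u x) \<le> M * y - M * x"
    proof (rule differentiable_bound_general[of x y u "\<lambda>t. M * t" u' "\<lambda>_. M"])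
      show "continuous_on {x..y} u" using c xy by (auto intro: continuous_on_subset)
      show "((*) M has_vector_derivative M) (at t)" for t
        unfolding has_real_derivative_iff_has_vector_derivative[symmetric]
        by (auto intro!: derivative_eq_intros)
    qed (use False xy d bd in \<open>auto intro!: continuous_intros\<close>)
    then show ?thesis
      using xy by (simp add: dist_norm norm_minus_commute algebra_simps)
  qed simp
qed (use assms in auto)

lemma lipschitz_on_glue:
  fixes u :: "real \<Rightarrow> 'a::metric_space"
  assumes "L-lipschitz_on {a..b} u" "M-lipschitz_on {b..c} u"
  shows "(max L M)-lipschitz_on {a..c} u"
  using lipschitz_on_concat_max[OF assms refl] by simp

lemma lipschitz_on_pointwise_limit:
  assumes "\<And>k. L-lipschitz_on S (X k)" "\<And>t. t \<in> S \<Longrightarrow> (\<lambda>k. X k t) \<longlonglongrightarrow> x t"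
  shows "L-lipschitz_on S x"
proof (rule lipschitz_onI)
  fix s t assume "s \<in> S" "t \<in> S"
  then have "(\<lambda>k. dist (X k s) (X k t)) \<longlonglongrightarrow> dist (x s) (x t)"
    using assms(2) by (intro tendsto_dist) auto
  then show "dist (x s) (x t) \<le> L * dist s t"
    by (rule LIMSEQ_le_const2) (use assms(1) \<open>s \<in> S\<close> \<open>t \<in> S\<close> lipschitz_onD in blast)
qed (use assms(1) lipschitz_on_nonneg in blast)

lemma lipschitz_on_all_intervals_continuous:
  fixes u :: "real \<Rightarrow> 'a::metric_space"
  assumes "\<And>T. T \<ge> a \<Longrightarrow> \<exists>M. M-lipschitz_on {a..T} u"
  shows "continuous_on {a..} u"
proof (unfold continuous_on_eq_continuous_within, intro ballI)
  fix t assume t: "t \<in> {a..}"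
  then obtain M where "M-lipschitz_on {a..t+1} u" using assms[of "t+1"] by auto
  then have "continuous (at t within {a..t+1}) u"
    using t by (auto dest!: lipschitz_on_continuous_on simp: continuous_on_eq_continuous_within)
  moreover have "at t within {a..t+1} = at t within {a..}"
    by (rule at_within_nhd[of _ "{..<t+1}"]) auto
  ultimately show "continuous (at t within {a..}) u" by simp
qed

lemma C1_on_imp_continuous_on: "C1_on I u \<Longrightarrow> continuous_on I u"
  unfolding C1_on_def continuous_on_eq_continuous_within
  by (blast intro: has_vector_derivative_continuous)

lemma C1_on_imp_lipschitz:
  assumes "C1_on {a..b} u"
  shows "\<exists>M. M-lipschitz_on {a..b} u"
proof -
  obtain u' where c: "continuous_on {a..b} u'"
    and d: "\<And>t. t \<in> {a..b} \<Longrightarrow> (u has_vector_derivative u' t) (at t within {a..b})"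
    using assms unfolding C1_on_def by auto
  obtain M where M: "M > 0" "\<And>t. t \<in> {a..b} \<Longrightarrow> norm (u' t) \<le> M"
    using compact_imp_bounded[OF compact_continuous_image[OF c compact_Icc]]
    by (auto simp: bounded_pos)
  have "M-lipschitz_on {a..b} u"
  proof (rule derivative_bound_lipschitz)
    show "continuous_on {a..b} u" using assms by (rule C1_on_imp_continuous_on)
    show "(u has_vector_derivative u' t) (at t)" if "a < t" "t < b" for t
      using d[of t] at_within_Icc_at[OF that] that by simp
  qed (use M in auto)
  then show ?thesis ..
qed

lemma C1_on_subset: "C1_on I u \<Longrightarrow> J \<subseteq> I \<Longrightarrow> C1_on J u"
  unfolding C1_on_def
  by (meson continuous_on_subset has_vector_derivative_within_subset subset_iff)

lemma C1_on_diff: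
  assumes "C1_on I u" "C1_on I v"
  shows "C1_on I (\<lambda>t. u t - v t)"
proof -
  obtain u' v' where "continuous_on I u'" "continuous_on I v'"
    "\<forall>t\<in>I. (u has_vector_derivative u' t) (at t within I)"
    "\<forall>t\<in>I. (v has_vector_derivative v' t) (at t within I)"
    using assms unfolding C1_on_def by auto
  then show ?thesis unfolding C1_on_def
    by (intro exI[of _ "\<lambda>t. u' t - v' t"])
      (auto intro!: continuous_intros has_vector_derivative_diff)
qed

text \<open>A supremum of reals bounds its members only if the set is bounded above.
  \<open>C1_on\<close> makes both sets of norms continuous images of a compact interval, and the
  derivative summand is then nonnegative.\<close>

lemma norm_le_C1_norm:
  fixes u :: "real \<Rightarrow> 'a::euclidean_space"
  assumes "C1_on {a..b} u" "a < b" "t \<in> {a..b}"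
  shows "norm (u t) \<le> C1_norm a b u"
proof -
  obtain u' where c: "continuous_on {a..b} u'"
    and d: "\<And>t. t \<in> {a..b} \<Longrightarrow> (u has_vector_derivative u' t) (at t within {a..b})"
    using assms unfolding C1_on_def by auto
  have bdd: "bdd_above ((\<lambda>t. norm (v t)) ` {a..b})" if "continuous_on {a..b} v"
    for v :: "real \<Rightarrow> 'a"
    by (intro bounded_imp_bdd_above compact_imp_bounded compact_continuous_image
        continuous_on_norm that compact_Icc)
  have e: "vector_derivative u (at t within {a..b}) = u' t" if "t \<in> {a..b}" for t
    using vector_derivative_within_closed_interval[OF assms(2) that d[OF that]] .
  have "norm (u t) \<le> (SUP t\<in>{a..b}. norm (u t))"
    by (rule cSUP_upper[OF assms(3) bdd[OF C1_on_imp_continuous_on[OF assms(1)]]])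
  moreover have "norm (u' t) \<le> (SUP t\<in>{a..b}. norm (u' t))"
    by (rule cSUP_upper[OF assms(3) bdd[OF c]])
  moreover have "(SUP t\<in>{a..b}. norm (vector_derivative u (at t within {a..b})))
      = (SUP t\<in>{a..b}. norm (u' t))"
    using e by (intro SUP_cong) auto
  ultimately show ?thesis unfolding C1_norm_def
    using norm_ge_zero[of "u' t"] by linarith
qed

text \<open>\<open>global_solution\<close> states the equations only for times after
  \<open>t0\<close>. At the endpoint the derivative exists by \<open>C1_on\<close>, and it must be
  \<open>F a\<close> because \<open>u'\<close> and \<open>F\<close> are continuous and agree to the
  right of \<open>a\<close>.\<close>

lemma C1_on_derivative_at_left_endpoint:
  assumes C1: "C1_on {a..} u" and F: "continuous_on {a..} F"
    and d: "\<And>t. t > a \<Longrightarrow> (u has_vector_derivative F t) (at t)" and "t \<ge> a"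
  shows "(u has_vector_derivative F t) (at t within {a..})"
proof (cases "t = a")
  case True
  obtain u' where c: "continuous_on {a..} u'"
    and u': "\<And>t. t \<in> {a..} \<Longrightarrow> (u has_vector_derivative u' t) (at t within {a..})"
    using C1 unfolding C1_on_def by auto
  have eq: "u' t = F t" if "t > a" for t
  proof -
    have "(u has_vector_derivative u' t) (at t)"
      using u'[of t] at_within_interior[of t "{a..}"] that by (simp add: interior_real_atLeast)
    with d[OF that] show ?thesis by (metis vector_derivative_unique_at)
  qed
  have l: "((\<lambda>t. v t) \<longlongrightarrow> v a) (at a within {a<..})" if "continuous_on {a..} v"
    for v :: "real \<Rightarrow> 'a"
    by (rule tendsto_within_subset[of _ _ _ "{a..}"])
      (use that in \<open>auto simp: continuous_on_def\<close>)
  have "(F \<longlongrightarrow> u' a) (at a within {a<..})"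
    by (rule Lim_transform_eventually[OF l[OF c]]) (auto simp: eventually_at_filter eq)
  then have "u' a = F a"
    using l[OF F] tendsto_unique[of "at a within {a<..}"] by (metis trivial_limit_at_right_real)
  then show ?thesis using u'[of a] True by simp
qed (use assms in \<open>auto intro: has_vector_derivative_at_within\<close>)

lemma integral_has_vector_derivative_atLeast:
  fixes F :: "real \<Rightarrow> 'a::banach"
  assumes "continuous_on {a..} F" "t \<ge> a"
  shows "((\<lambda>t. integral {a..t} F) has_vector_derivative F t) (at t within {a..})"
proof -
  have "((\<lambda>t. integral {a..t} F) has_vector_derivative F t) (at t within {a..t+1})"
    by (rule integral_has_vector_derivative) (use assms in \<open>auto intro: continuous_on_subset\<close>)
  moreover have "at t within {a..t+1} = at t within {a..}"
    by (rule at_within_nhd[of _ "{..<t+1}"]) auto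
  ultimately show ?thesis by simp
qed

text \<open>A barrier argument: if \<open>r b\<close> were negative, then after the last
  zero-or-positive time \<tau> in \<open>[a, b]\<close> the function would stay negative, hence be
  nondecreasing, and \<open>r b\<close> could not be below \<open>r \<tau>\<close>.\<close>

lemma nonneg_if_derivative_nonneg_where_negative:
  fixes r :: "real \<Rightarrow> real"
  assumes c: "continuous_on {a..} r" and "r a \<ge> 0" and "a \<le> b"
    and d: "\<And>t. t > a \<Longrightarrow> r t < 0 \<Longrightarrow> \<exists>D\<ge>0. (r has_real_derivative D) (at t)"
  shows "r b \<ge> 0"
proof (rule ccontr)
  assume neg: "\<not> r b \<ge> 0"
  let ?S = "{t\<in>{a..b}. 0 \<le> r t}"
  have "continuous_on {a..b} r" using c by (auto intro: continuous_on_subset)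
  then have "closed ({a..b} \<inter> r -` {0..})" by (intro continuous_closed_preimage) auto
  moreover have "{a..b} \<inter> r -` {0..} = ?S" by auto
  ultimately have cl: "closed ?S" by simp
  define \<tau> where "\<tau> = Sup ?S"
  have ne: "a \<in> ?S" using assms by auto
  have bd: "bdd_above ?S" by (auto intro: bdd_aboveI[of _ b])
  have \<tau>: "\<tau> \<in> ?S" unfolding \<tau>_def by (rule closed_contains_Sup[OF _ bd cl]) (use ne in blast)
  have "r t < 0" if "\<tau> < t" "t < b" for t
  proof (rule ccontr)
    assume "\<not> r t < 0"
    then have "t \<in> ?S" using that \<tau> by auto
    then have "t \<le> \<tau>" unfolding \<tau>_def using bd by (rule cSup_upper)
    with that show False by simp
  qed
  then have D: "\<exists>D. (r has_real_derivative D) (at t) \<and> D \<ge> 0" if "\<tau> < t" "t < b" for t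
    using d[of t] that \<tau> by auto
  have "r \<tau> \<le> r b"
  proof (rule DERIV_nonneg_imp_increasing_open[OF _ D])
    show "continuous_on {\<tau>..b} r" using \<tau> by (intro continuous_on_subset[OF c]) auto
  qed (use \<tau> in auto)
  then show False using \<tau> neg by auto
qed

lemma geometric_increments_converge:
  fixes X :: "nat \<Rightarrow> 'a::banach"
  assumes "\<And>k. norm (X (Suc k) - X k) \<le> c / 2 ^ k"
  shows "X \<longlonglongrightarrow> lim X" and "\<And>k. norm (lim X - X k) \<le> 2 * c / 2 ^ k"
proof -
  \<comment> \<open>The subtracted term is the remaining tail of the geometric series; without it
    the induction on \<open>j\<close> would not close.\<close>
  have tail: "norm (X (k + j) - X k) \<le> 2 * c / 2 ^ k - 2 * c / 2 ^ (k + j)" for k j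
  proof (induction j)
    case (Suc j)
    have "norm (X (k + Suc j) - X k) \<le> norm (X (Suc (k + j)) - X (k + j)) + norm (X (k + j) - X k)"
      using norm_triangle_ineq[of "X (Suc (k + j)) - X (k + j)" "X (k + j) - X k"] by simp
    also have "\<dots> \<le> c / 2 ^ (k + j) + (2 * c / 2 ^ k - 2 * c / 2 ^ (k + j))"
      using Suc assms by (intro add_mono)
    also have "\<dots> = 2 * c / 2 ^ k - 2 * c / 2 ^ (k + Suc j)" by (simp add: field_simps)
    finally show ?case .
  qed simp
  have "summable (\<lambda>k. X (Suc k) - X k)"
  proof (rule summable_comparison_test)
    show "\<exists>N. \<forall>n\<ge>N. norm (X (Suc n) - X n) \<le> c * (1 / 2) ^ n"
      using assms by (auto simp: power_divide)
    show "summable (\<lambda>n. c * (1 / 2) ^ n)" by (intro summable_mult summable_geometric) simp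
  qed
  then have "convergent (\<lambda>n. (\<Sum>k<n. X (Suc k) - X k) + X 0)"
    by (intro convergent_add convergent_const) (simp add: summable_iff_convergent)
  then have "convergent X" by (simp add: sum_lessThan_telescope)
  then show L: "X \<longlonglongrightarrow> lim X" by (rule convergent_LIMSEQ_iff[THEN iffD1])
  fix k
  have "c \<ge> 0" using order_trans[OF norm_ge_zero assms[of 0]] by simp
  have "(\<lambda>j. norm (X (j + k) - X k)) \<longlonglongrightarrow> norm (lim X - X k)"
    using LIMSEQ_ignore_initial_segment[OF L] by (intro tendsto_intros)
  then show "norm (lim X - X k) \<le> 2 * c / 2 ^ k"
  proof (rule LIMSEQ_le_const2, intro exI allI impI)
    fix j show "norm (X (j + k) - X k) \<le> 2 * c / 2 ^ k"
      using tail[of k j] \<open>c \<ge> 0\<close> by (simp add: add.commute) (smt (verit) divide_nonneg_pos zero_less_power)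
  qed
qed

subsection \<open>The delay system and its Picard iterates\<close>

locale delay_system =
  fixes f :: "real \<times> (real^'m) \<times> (real^'m) \<Rightarrow> real^'m" and G :: "real^'m \<Rightarrow> real"
    and \<mu> etat h t0 Lf LG :: real
  assumes etat_pos: "etat > 0" and h_eq: "h = 2 * etat"
    and lip_f: "Lf-lipschitz_on UNIV f" and lip_G: "LG-lipschitz_on UNIV G"
    and G_bound: "\<bar>G x\<bar> \<le> \<mu> * etat" and mu_etat_less: "\<mu> * etat < 1/2"
begin

section \<open>Elementary estimates for the right-hand side\<close>

lemma h_pos: "h > 0" using etat_pos h_eq by simp

lemma mu_nonneg: "\<mu> \<ge> 0"
proof -
  have "0 \<le> \<mu> * etat" using G_bound[of 0] by linarith
  then show ?thesis using etat_pos by (simp add: zero_le_mult_iff)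
qed

lemma Lf_nonneg: "Lf \<ge> 0" and LG_nonneg: "LG \<ge> 0"
  using lip_f lip_G lipschitz_on_nonneg by auto

lemma f_diff: "norm (f (t, a, b) - f (t, a', b')) \<le> Lf * (norm (a - a') + norm (b - b'))"
proof -
  have "norm (f (t, a, b) - f (t, a', b')) \<le> Lf * norm ((t, a, b) - (t, a', b'))"
    using lipschitz_on_normD[OF lip_f] by blast
  also have "norm ((t, a, b) - (t, a', b')) \<le> norm (a - a') + norm (b - b')"
    using norm_Pair_le[of "0::real" "(a - a', b - b')"] norm_Pair_le[of "a - a'" "b - b'"] by simp
  finally show ?thesis using Lf_nonneg by (simp add: mult_left_mono)
qed

lemma f_growth: "norm (f (t, a, b)) \<le> norm (f 0) + Lf * (\<bar>t\<bar> + norm a + norm b)"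
proof -
  have "norm (f (t, a, b)) \<le> norm (f 0) + norm (f (t, a, b) - f 0)"
    using norm_triangle_ineq[of "f 0" "f (t, a, b) - f 0"] by simp
  also have "norm (f (t, a, b) - f 0) \<le> Lf * norm ((t, a, b) - 0)"
    using lipschitz_on_normD[OF lip_f] by blast
  also have "norm ((t, a, b) - 0) \<le> \<bar>t\<bar> + norm a + norm b"
    using norm_Pair_le[of t "(a, b)"] norm_Pair_le[of a b] by simp
  finally show ?thesis using Lf_nonneg by (simp add: mult_left_mono)
qed

lemma G_diff: "\<bar>G a - G b\<bar> \<le> LG * norm (a - b)"
  using lipschitz_on_normD[OF lip_G, of a b] by simp

lemma delayed_continuous:
  assumes "continuous_on {t0 - h..} v" "continuous_on {t0..} \<xi>"
    and "\<And>t. t \<ge> t0 \<Longrightarrow> \<xi> t \<in> {0..h}"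
  shows "continuous_on {t0..} (\<lambda>t. f (t, v t, v (t - \<xi> t)))"
    and "continuous_on {t0..} (\<lambda>t. - \<mu> * (\<xi> t - etat) + G (v t))"
proof -
  have v: "continuous_on {t0..} v"
    using assms(1) by (rule continuous_on_subset) (use h_pos in auto)
  have "(\<lambda>t. t - \<xi> t) ` {t0..} \<subseteq> {t0 - h..}" using assms(3) by fastforce
  then have "continuous_on {t0..} (\<lambda>t. v (t - \<xi> t))"
    by (intro continuous_on_compose2[OF assms(1)] continuous_intros assms(2))
  with v show "continuous_on {t0..} (\<lambda>t. f (t, v t, v (t - \<xi> t)))"
    by (intro continuous_on_compose2[OF lipschitz_on_continuous_on[OF lip_f]] continuous_intros) auto
  have "continuous_on {t0..} (\<lambda>t. G (v t))"
    using v by (intro continuous_on_compose2[OF lipschitz_on_continuous_on[OF lip_G]]) auto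
  then show "continuous_on {t0..} (\<lambda>t. - \<mu> * (\<xi> t - etat) + G (v t))"
    by (intro continuous_intros assms(2))
qed

text \<open>\<open>(u, r)\<close> solves the system in whose right-hand side the unknowns have been replaced by
  \<open>(v, \<xi>)\<close>: the case \<open>(u, r) = (v, \<xi>)\<close> is a solution, the general case a Picard step.\<close>

definition driven ::
  "real \<Rightarrow> (real \<Rightarrow> real^'m) \<Rightarrow> (real \<Rightarrow> real) \<Rightarrow> (real \<Rightarrow> real^'m) \<Rightarrow> (real \<Rightarrow> real) \<Rightarrow> bool" where
  "driven T v \<xi> u r \<longleftrightarrow> continuous_on {t0..T} u \<and> continuous_on {t0..T} r \<and>
     (\<forall>t\<in>{t0<..<T}. (u has_vector_derivative f (t, v t, v (t - \<xi> t))) (at t) \<and>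
        (r has_real_derivative - \<mu> * (\<xi> t - etat) + G (v t)) (at t))"

text \<open>Distance at most \<open>N\<close> in a weighted sup norm. For \<open>K > 0\<close> the
  weight increases through the history interval as well, so a delayed time never carries more weight
  than the current one; on the history the weight lies between \<open>exp (- K * h)\<close> and
  1.\<close>

definition close_within ::
  "real \<Rightarrow> real \<Rightarrow> real \<Rightarrow> (real \<Rightarrow> real^'m) \<Rightarrow> (real \<Rightarrow> real) \<Rightarrow> (real \<Rightarrow> real^'m) \<Rightarrow> (real \<Rightarrow> real) \<Rightarrow> bool"
  where "close_within T K N v \<xi> w \<zeta> \<longleftrightarrow>
    (\<forall>t\<in>{t0 - h..T}. norm (v t - w t) \<le> N * exp (K * (t - t0))) \<and>
    (\<forall>t\<in>{t0..T}. \<bar>\<xi> t - \<zeta> t\<bar> \<le> N * exp (K * (t - t0)))"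

text \<open>In \<open>Lf * (2 + M)\<close> one \<open>Lf\<close> accounts for the current value, one
  for the delayed value at equal delays, and \<open>Lf * M\<close> for the difference of the delays;
  \<open>\<mu> + LG\<close> belongs to the delay equation. Doubling the sum yields the contraction
  factor \<open>1/2\<close>, and the added 1 keeps the rate positive.\<close>

definition rate :: "real \<Rightarrow> real" where
  "rate M = 2 * (Lf * (2 + M) + \<mu> + LG) + 1"

lemma rate_pos: "M \<ge> 0 \<Longrightarrow> rate M > 0"
  unfolding rate_def using Lf_nonneg LG_nonneg mu_nonneg by (simp add: add_nonneg_pos)

text \<open>The weight \<open>exp (K * (t - t0))\<close> makes a Picard step contract by the factor \<open>1/2\<close>. The delay
  enters the right-hand side through \<open>v (t - \<xi> t)\<close>, so a Lipschitz constant of one of the two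
  functions \<open>v\<close> is needed.\<close>

lemma driven_diff:
  assumes d1: "driven T v1 \<xi>1 u1 r1" and d2: "driven T v2 \<xi>2 u2 r2"
    and \<xi>: "\<And>t. t \<in> {t0..T} \<Longrightarrow> \<xi>1 t \<in> {0..h} \<and> \<xi>2 t \<in> {0..h}"
    and M: "M-lipschitz_on {t0 - h..T} v2"
    and cl: "close_within T (rate M) N v1 \<xi>1 v2 \<xi>2" and "N \<ge> 0"
    and i: "norm (u1 t0 - u2 t0) \<le> \<delta>" "\<bar>r1 t0 - r2 t0\<bar> \<le> \<delta>"
    and t: "t \<in> {t0..T}"
  shows "norm (u1 t - u2 t) \<le> \<delta> + N / 2 * exp (rate M * (t - t0))"
    and "\<bar>r1 t - r2 t\<bar> \<le> \<delta> + N / 2 * exp (rate M * (t - t0))"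
proof -
  define K where "K = rate M"
  have "M \<ge> 0" using M by (rule lipschitz_on_nonneg)
  then have K: "K > 0" "K \<ge> 0" unfolding K_def using rate_pos by (auto simp: less_imp_le)
  have cv: "norm (v1 s - v2 s) \<le> N * exp (K * (s - t0))" if "s \<in> {t0 - h..T}" for s
    using cl that unfolding close_within_def K_def by blast
  have c\<xi>: "\<bar>\<xi>1 s - \<xi>2 s\<bar> \<le> N * exp (K * (s - t0))" if "s \<in> {t0..T}" for s
    using cl that unfolding close_within_def K_def by blast
  have "\<mu> + LG + Lf * (2 + M) \<le> K / 2" unfolding K_def rate_def by simp
  moreover have "0 \<le> Lf * (2 + M)" using Lf_nonneg \<open>M \<ge> 0\<close> by simp
  ultimately have Kle: "Lf * (2 + M) \<le> K / 2" "\<mu> + LG \<le> K / 2"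
    using LG_nonneg mu_nonneg by auto
  have du: "((\<lambda>t. u1 t - u2 t) has_vector_derivative
      f (s, v1 s, v1 (s - \<xi>1 s)) - f (s, v2 s, v2 (s - \<xi>2 s))) (at s)"
    and dr: "((\<lambda>t. r1 t - r2 t) has_vector_derivative
      (- \<mu> * (\<xi>1 s - etat) + G (v1 s)) - (- \<mu> * (\<xi>2 s - etat) + G (v2 s))) (at s)"
    if "t0 < s" "s < t" for s
    using that d1 d2 t unfolding driven_def has_real_derivative_iff_has_vector_derivative
    by (auto intro!: has_vector_derivative_diff)
  have bu: "norm (f (s, v1 s, v1 (s - \<xi>1 s)) - f (s, v2 s, v2 (s - \<xi>2 s)))
      \<le> K / 2 * N * exp (K * (s - t0))"
    and br: "norm ((- \<mu> * (\<xi>1 s - etat) + G (v1 s)) - (- \<mu> * (\<xi>2 s - etat) + G (v2 s)))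
      \<le> K / 2 * N * exp (K * (s - t0))"
    if s: "t0 < s" "s < t" for s
  proof -
    define E where "E = N * exp (K * (s - t0))"
    have E: "E \<ge> 0" unfolding E_def using \<open>N \<ge> 0\<close> by simp
    have sT: "s \<in> {t0..T}" "s \<in> {t0 - h..T}" using s t h_pos by auto
    have sd: "s - \<xi>1 s \<in> {t0 - h..T}" "s - \<xi>2 s \<in> {t0 - h..T}"
      using \<xi>[OF sT(1)] s t by auto
    \<comment> \<open>The delayed difference is split at \<open>v2 (s - \<xi>1 s)\<close>: first the
      function changes at a fixed delay, then the delay changes in a fixed function. Only the second
      part costs \<open>M\<close>, and only \<open>v2\<close> has to be Lipschitz.\<close>
    have "norm (v1 (s - \<xi>1 s) - v2 (s - \<xi>1 s)) \<le> N * exp (K * (s - \<xi>1 s - t0))"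
      using cv[OF sd(1)] .
    also have "\<dots> \<le> E" unfolding E_def using \<xi>[OF sT(1)] \<open>N \<ge> 0\<close> K
      by (intro mult_left_mono) (auto intro: mult_left_mono)
    finally have 1: "norm (v1 (s - \<xi>1 s) - v2 (s - \<xi>1 s)) \<le> E" .
    have "norm (v2 (s - \<xi>1 s) - v2 (s - \<xi>2 s)) \<le> M * \<bar>\<xi>1 s - \<xi>2 s\<bar>"
      using lipschitz_on_normD[OF M sd] by (simp add: abs_minus_commute)
    also have "\<dots> \<le> M * E" unfolding E_def using c\<xi>[OF sT(1)] \<open>M \<ge> 0\<close> by (rule mult_left_mono)
    finally have 2: "norm (v2 (s - \<xi>1 s) - v2 (s - \<xi>2 s)) \<le> M * E" .
    have 3: "norm (v1 (s - \<xi>1 s) - v2 (s - \<xi>2 s)) \<le> E + M * E"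
      using norm_triangle_ineq[of "v1 (s - \<xi>1 s) - v2 (s - \<xi>1 s)" "v2 (s - \<xi>1 s) - v2 (s - \<xi>2 s)"] 1 2
      by simp
    have 4: "norm (v1 s - v2 s) \<le> E" unfolding E_def using cv[OF sT(2)] .
    have "norm (f (s, v1 s, v1 (s - \<xi>1 s)) - f (s, v2 s, v2 (s - \<xi>2 s)))
        \<le> Lf * (norm (v1 s - v2 s) + norm (v1 (s - \<xi>1 s) - v2 (s - \<xi>2 s)))"
      by (rule f_diff)
    also have "\<dots> \<le> Lf * (E + (E + M * E))"
      using 3 4 Lf_nonneg by (intro mult_left_mono add_mono)
    also have "\<dots> = Lf * (2 + M) * E" by (simp add: algebra_simps)
    also have "\<dots> \<le> K / 2 * E" using Kle(1) E by (rule mult_right_mono)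
    finally show "norm (f (s, v1 s, v1 (s - \<xi>1 s)) - f (s, v2 s, v2 (s - \<xi>2 s)))
      \<le> K / 2 * N * exp (K * (s - t0))" by (simp add: E_def)
    have "\<bar>\<mu> * (\<xi>1 s - \<xi>2 s)\<bar> \<le> \<mu> * E"
      unfolding abs_mult E_def using c\<xi>[OF sT(1)] mu_nonneg by (simp add: mult_left_mono)
    moreover have "\<bar>G (v1 s) - G (v2 s)\<bar> \<le> LG * E"
      using G_diff[of "v1 s" "v2 s"] mult_left_mono[OF 4 LG_nonneg] by linarith
    ultimately have "\<bar>(- \<mu> * (\<xi>1 s - etat) + G (v1 s)) - (- \<mu> * (\<xi>2 s - etat) + G (v2 s))\<bar>
        \<le> (\<mu> + LG) * E" by (simp add: algebra_simps)
    also have "\<dots> \<le> K / 2 * E" using Kle(2) E by (rule mult_right_mono)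
    finally show "norm ((- \<mu> * (\<xi>1 s - etat) + G (v1 s)) - (- \<mu> * (\<xi>2 s - etat) + G (v2 s)))
      \<le> K / 2 * N * exp (K * (s - t0))" by (simp add: E_def)
  qed
  have cu: "continuous_on {t0..t} (\<lambda>t. u1 t - u2 t)" "continuous_on {t0..t} (\<lambda>t. r1 t - r2 t)"
    using d1 d2 t unfolding driven_def
    by (auto intro!: continuous_intros intro: continuous_on_subset)
  have "t0 \<le> t" using t by simp
  have "0 \<le> K / 2 * N" using K \<open>N \<ge> 0\<close> by simp
  have q: "K / 2 * N / K = N / 2" using K by simp
  have A: "norm ((u1 t - u2 t) - (u1 t0 - u2 t0)) \<le> N / 2 * exp (K * (t - t0))"
    using derivative_exp_bound[OF \<open>t0 \<le> t\<close> cu(1) du bu \<open>0 \<le> K / 2 * N\<close> K(1)] unfolding q .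
  have B: "norm ((r1 t - r2 t) - (r1 t0 - r2 t0)) \<le> N / 2 * exp (K * (t - t0))"
    using derivative_exp_bound[OF \<open>t0 \<le> t\<close> cu(2) dr br \<open>0 \<le> K / 2 * N\<close> K(1)] unfolding q .
  show "norm (u1 t - u2 t) \<le> \<delta> + N / 2 * exp (rate M * (t - t0))"
    using A i(1) norm_triangle_sub[of "u1 t - u2 t" "u1 t0 - u2 t0"] unfolding K_def by linarith
  show "\<bar>r1 t - r2 t\<bar> \<le> \<delta> + N / 2 * exp (rate M * (t - t0))"
    using B i(2) unfolding K_def real_norm_def by linarith
qed

text \<open>Supplies the finite constant at which the halving arguments start; it may be arbitrarily
  bad.\<close>

lemma close_within_exists:
  assumes "continuous_on {t0 - h..T} v1" "continuous_on {t0..T} \<xi>1"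
    and "continuous_on {t0 - h..T} v2" "continuous_on {t0..T} \<xi>2"
  shows "\<exists>N\<ge>0. close_within T K N v1 \<xi>1 v2 \<xi>2"
proof -
  have ex: "\<exists>B\<ge>0. \<forall>t\<in>{a..T}. norm (w t) \<le> B * exp (K * (t - t0))"
    if "continuous_on {a..T} w" for a and w :: "real \<Rightarrow> 'b::real_normed_vector"
  proof -
    have "continuous_on {a..T} (\<lambda>t. exp (- (K * (t - t0))) *\<^sub>R w t)"
      by (intro continuous_intros that)
    from compact_imp_bounded[OF compact_continuous_image[OF this compact_Icc]]
    obtain B where B: "B > 0" "\<And>t. t \<in> {a..T} \<Longrightarrow> norm (exp (- (K * (t - t0))) *\<^sub>R w t) \<le> B"
      by (auto simp: bounded_pos)
    have "norm (w t) \<le> B * exp (K * (t - t0))" if "t \<in> {a..T}" for t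
    proof -
      define x where "x = K * (t - t0)"
      have "exp (- x) * norm (w t) \<le> B" using B(2)[OF that] unfolding x_def by simp
      then have "norm (w t) \<le> B * exp x" by (simp add: exp_minus field_simps)
      then show ?thesis unfolding x_def .
    qed
    with B(1) show ?thesis by (intro exI[of _ B]) auto
  qed
  obtain B1 B2 where B: "B1 \<ge> 0" "B2 \<ge> 0"
    "\<forall>t\<in>{t0 - h..T}. norm (v1 t - v2 t) \<le> B1 * exp (K * (t - t0))"
    "\<forall>t\<in>{t0..T}. norm (\<xi>1 t - \<xi>2 t) \<le> B2 * exp (K * (t - t0))"
    using ex[OF continuous_on_diff[OF assms(1,3)]] ex[OF continuous_on_diff[OF assms(2,4)]] by blast
  have *: "c * exp x \<le> max B1 B2 * exp x" if "c \<in> {B1, B2}" for c and x :: real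
    using that by (intro mult_right_mono) auto
  show ?thesis unfolding close_within_def
    by (rule exI[of _ "max B1 B2"]) (use B * in \<open>fastforce intro: order_trans\<close>)
qed

text \<open>Where \<open>r\<close> is negative, \<open>- \<mu> * (\<kappa> t - etat)\<close> is at
  least \<open>\<mu> * etat\<close> and outweighs \<open>G\<close>, so \<open>r\<close> cannot
  decrease; above \<open>h = 2 * etat\<close> the signs are reversed. The separate function \<kappa>
  lets one lemma serve both the clipped delay (in the existence proof) and the delay itself (for a
  given solution).\<close>

lemma delay_stays_in_range:
  assumes c: "continuous_on {t0..} r" and i: "r t0 \<in> {0..h}" and t: "t \<ge> t0"
    and d: "\<And>t. t > t0 \<Longrightarrow> (r has_real_derivative - \<mu> * (\<kappa> t - etat) + G (v t)) (at t)"
    and \<kappa>: "\<And>t. r t < 0 \<Longrightarrow> \<kappa> t \<le> 0" "\<And>t. r t > h \<Longrightarrow> \<kappa> t \<ge> h"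
  shows "r t \<in> {0..h}"
proof -
  have "0 \<le> r t"
  proof (rule nonneg_if_derivative_nonneg_where_negative[OF c _ t])
    fix s assume s: "t0 < s" "r s < 0"
    have "\<mu> * (\<kappa> s) \<le> 0" using \<kappa>(1)[OF s(2)] mu_nonneg by (simp add: mult_nonneg_nonpos)
    then have "0 \<le> - \<mu> * (\<kappa> s - etat) + G (v s)"
      using G_bound[of "v s"] by (simp add: algebra_simps)
    with d[OF s(1)] show "\<exists>D\<ge>0. (r has_real_derivative D) (at s)" by blast
  qed (use i in auto)
  moreover have "0 \<le> h - r t"
  proof (rule nonneg_if_derivative_nonneg_where_negative[of t0 "\<lambda>t. h - r t"])
    fix s assume s: "t0 < s" "h - r s < 0"
    have "\<mu> * (2 * etat) \<le> \<mu> * \<kappa> s"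
      using \<kappa>(2)[of s] s(2) mu_nonneg h_eq by (intro mult_left_mono) auto
    then have "0 \<le> - (- \<mu> * (\<kappa> s - etat) + G (v s))"
      using G_bound[of "v s"] by (simp add: algebra_simps)
    moreover have "((\<lambda>t. h - r t) has_real_derivative - (- \<mu> * (\<kappa> s - etat) + G (v s))) (at s)"
      by (auto intro!: derivative_eq_intros d[OF s(1)])
    ultimately show "\<exists>D\<ge>0. ((\<lambda>t. h - r t) has_real_derivative D) (at s)" by blast
  qed (use i t in \<open>auto intro!: continuous_intros c\<close>)
  ultimately show ?thesis by auto
qed

text \<open>The equations are solved with the delay clipped to \<open>[0, h]\<close>; by
  \<open>delay_stays_in_range\<close> the clipping is without effect on the solution.\<close>

definition clip :: "real \<Rightarrow> real" where "clip x = max 0 (min h x)"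

lemma clip_in: "clip x \<in> {0..h}"
  unfolding clip_def using h_pos by auto

lemma clip_diff: "\<bar>clip x - clip y\<bar> \<le> \<bar>x - y\<bar>"
  unfolding clip_def by (auto simp: max_def min_def)

lemma close_within_clip:
  assumes "close_within T K N v e w e'"
  shows "close_within T K N v (\<lambda>t. clip (e t)) w (\<lambda>t. clip (e' t))"
  using assms unfolding close_within_def by (meson clip_diff order_trans)

text \<open>For \<open>t < t0\<close> the interval \<open>{t0..t}\<close> is empty and the integral
  vanishes, so a single formula gives the history and the integrated equation.\<close>

definition step_y :: "(real \<Rightarrow> real^'m) \<Rightarrow> (real \<Rightarrow> real^'m) \<Rightarrow> (real \<Rightarrow> real) \<Rightarrow> real \<Rightarrow> real^'m" where
  "step_y g v e t = g (min t t0) + integral {t0..t} (\<lambda>s. f (s, v s, v (s - clip (e s))))"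

definition step_\<eta> :: "real \<Rightarrow> (real \<Rightarrow> real^'m) \<Rightarrow> (real \<Rightarrow> real) \<Rightarrow> real \<Rightarrow> real" where
  "step_\<eta> e0 v e t = e0 + integral {t0..t} (\<lambda>s. - \<mu> * (clip (e s) - etat) + G (v s))"

lemma step_y_initial: "t \<le> t0 \<Longrightarrow> step_y g v e t = g t"
  unfolding step_y_def by (cases "t = t0") (auto simp: min_def)

lemma step_\<eta>_initial: "step_\<eta> e0 v e t0 = e0"
  unfolding step_\<eta>_def by simp

lemma clipped_continuous:
  assumes v: "continuous_on {t0 - h..} v" and e: "continuous_on {t0..} e"
  shows "continuous_on {t0..} (\<lambda>t. f (t, v t, v (t - clip (e t))))"
    and "continuous_on {t0..} (\<lambda>t. - \<mu> * (clip (e t) - etat) + G (v t))"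
proof -
  have c: "continuous_on {t0..} (\<lambda>t. clip (e t))"
    unfolding clip_def by (intro continuous_intros e)
  show "continuous_on {t0..} (\<lambda>t. f (t, v t, v (t - clip (e t))))"
    "continuous_on {t0..} (\<lambda>t. - \<mu> * (clip (e t) - etat) + G (v t))"
    by (rule delayed_continuous[OF v c clip_in])+
qed

lemma step_derivative:
  assumes "continuous_on {t0 - h..} v" "continuous_on {t0..} e" "t \<ge> t0"
  shows "(step_y g v e has_vector_derivative f (t, v t, v (t - clip (e t)))) (at t within {t0..})"
    and "(step_\<eta> e0 v e has_real_derivative - \<mu> * (clip (e t) - etat) + G (v t)) (at t within {t0..})"
proof -
  note cc = clipped_continuous[OF assms(1,2)]
  let ?F = "\<lambda>t. f (t, v t, v (t - clip (e t)))"
  have "((\<lambda>t. g t0 + integral {t0..t} ?F) has_vector_derivative ?F t) (at t within {t0..})"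
    using has_vector_derivative_add[OF has_vector_derivative_const
      integral_has_vector_derivative_atLeast[OF cc(1) assms(3)]] by simp
  then show "(step_y g v e has_vector_derivative ?F t) (at t within {t0..})"
    by (rule has_vector_derivative_transform[rotated 2]) (use assms(3) in \<open>auto simp: step_y_def\<close>)
  show "(step_\<eta> e0 v e has_real_derivative - \<mu> * (clip (e t) - etat) + G (v t)) (at t within {t0..})"
    using has_vector_derivative_add[OF has_vector_derivative_const
      integral_has_vector_derivative_atLeast[OF cc(2) assms(3)]]
    unfolding step_\<eta>_def[abs_def] has_real_derivative_iff_has_vector_derivative by simp
qed

lemma step_continuous:
  assumes "continuous_on {t0 - h..} v" "continuous_on {t0..} e" and g: "continuous_on {t0 - h..t0} g"
  shows "continuous_on {t0 - h..} (step_y g v e)" "continuous_on {t0..} (step_\<eta> e0 v e)"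
proof -
  show "continuous_on {t0..} (step_\<eta> e0 v e)"
    unfolding continuous_on_eq_continuous_within
    using step_derivative(2)[OF assms(1,2)] by (auto intro: has_field_derivative_imp_has_derivative has_derivative_continuous)
  have "continuous_on {t0..} (step_y g v e)"
    unfolding continuous_on_eq_continuous_within
    using step_derivative(1)[OF assms(1,2)] by (auto intro: has_vector_derivative_continuous)
  moreover have "continuous_on {t0 - h..t0} (step_y g v e)"
    using g by (rule continuous_on_eq) (simp add: step_y_initial)
  ultimately have "continuous_on ({t0 - h..t0} \<union> {t0..}) (step_y g v e)"
    by (intro continuous_on_closed_Un) auto
  moreover have "{t0 - h..t0} \<union> {t0..} = {t0 - h..}" using h_pos by auto
  ultimately show "continuous_on {t0 - h..} (step_y g v e)" by simp
qed

lemma driven_step: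
  assumes "continuous_on {t0 - h..} v" "continuous_on {t0..} e" "continuous_on {t0 - h..t0} g"
  shows "driven T v (\<lambda>t. clip (e t)) (step_y g v e) (step_\<eta> e0 v e)"
  unfolding driven_def
proof (intro conjI ballI)
  show "continuous_on {t0..T} (step_y g v e)" "continuous_on {t0..T} (step_\<eta> e0 v e)"
    using h_pos by (auto intro: continuous_on_subset[OF step_continuous(1)[OF assms]]
        continuous_on_subset[OF step_continuous(2)[OF assms]])
  fix t assume t: "t \<in> {t0<..<T}"
  then have "at t within {t0..} = at t"
    by (intro at_within_interior) (auto simp: interior_real_atLeast)
  then show "(step_y g v e has_vector_derivative f (t, v t, v (t - clip (e t)))) (at t)"
    "(step_\<eta> e0 v e has_real_derivative - \<mu> * (clip (e t) - etat) + G (v t)) (at t)"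
    using step_derivative[OF assms(1,2), of t] t by auto
qed

text \<open>A weighted ball of radius \<open>B\<close> is mapped into itself. The linear growth of
  \<open>f\<close> contributes at most \<open>A + B / 2\<close>, the initial value at most \<Gamma>,
  and \<open>B\<close> is at least twice \<open>\<Gamma> + A\<close>; its factor
  \<open>exp (C * h)\<close> makes up for the small weight on the history. A bound on
  \<open>v\<close> then bounds the derivative of the step, whence a Lipschitz constant that does not
  refer to the one of \<open>v\<close>.\<close>

lemma step_growth:
  assumes v: "continuous_on {t0 - h..} v" and e: "continuous_on {t0..} e"
    and g: "continuous_on {t0 - h..t0} g"
    and \<Gamma>: "\<And>t. t \<in> {t0 - h..t0} \<Longrightarrow> norm (g t) \<le> \<Gamma>"
    and A: "A = norm (f 0) + Lf * (\<bar>t0\<bar> + \<bar>T\<bar>)" and C: "C = 4 * Lf + 1"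
    and B: "B = 2 * (\<Gamma> + A) * exp (C * h)"
    and bd: "\<And>t. t \<in> {t0 - h..T} \<Longrightarrow> norm (v t) \<le> B * exp (C * (t - t0))"
  shows "t \<in> {t0 - h..T} \<Longrightarrow> norm (step_y g v e t) \<le> B * exp (C * (t - t0))"
    and "t0 \<le> T \<Longrightarrow> (A + 2 * Lf * (B * exp (C * (T - t0))))-lipschitz_on {t0..T} (step_y g v e)"
proof -
  have C1: "C \<ge> 1" unfolding C using Lf_nonneg by simp
  have A0: "A \<ge> 0" unfolding A using Lf_nonneg by simp
  have \<Gamma>0: "\<Gamma> \<ge> 0" using order_trans[OF norm_ge_zero \<Gamma>[of t0]] h_pos by simp
  have B': "2 * (\<Gamma> + A) \<le> B"
    unfolding B using C1 h_pos \<Gamma>0 A0 by (intro le_mult_exp) auto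
  have B0: "B \<ge> 0" unfolding B using \<Gamma>0 A0 by simp
  have F: "norm (f (s, v s, v (s - clip (e s)))) \<le> A + 2 * Lf * (B * exp (C * (s - t0)))"
    if s: "s \<in> {t0..T}" for s
  proof -
    have "norm (v (s - clip (e s))) \<le> B * exp (C * (s - clip (e s) - t0))"
      using s clip_in[of "e s"] by (intro bd) auto
    also have "\<dots> \<le> B * exp (C * (s - t0))"
      using B0 C1 clip_in[of "e s"] by (intro mult_left_mono) auto
    finally have "norm (v (s - clip (e s))) \<le> B * exp (C * (s - t0))" .
    moreover have "norm (v s) \<le> B * exp (C * (s - t0))" using s h_pos by (intro bd) auto
    moreover have "\<bar>s\<bar> \<le> \<bar>t0\<bar> + \<bar>T\<bar>" using s by auto
    ultimately have "Lf * (\<bar>s\<bar> + norm (v s) + norm (v (s - clip (e s))))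
      \<le> Lf * ((\<bar>t0\<bar> + \<bar>T\<bar>) + B * exp (C * (s - t0)) + B * exp (C * (s - t0)))"
      using Lf_nonneg by (intro mult_left_mono add_mono) auto
    then show ?thesis using f_growth[of s "v s" "v (s - clip (e s))"] unfolding A
      by (simp add: algebra_simps)
  qed
  note dr = driven_step[OF v e g, of T, unfolded driven_def]
  have co: "continuous_on {t0..t} (step_y g v e)" if "t \<le> T" for t
    using that dr by (meson continuous_on_subset atLeastatMost_subset_iff order_refl)
  show "norm (step_y g v e t) \<le> B * exp (C * (t - t0))" if t: "t \<in> {t0 - h..T}"
  proof (cases "t \<le> t0")
    case True
    have "norm (g t) \<le> \<Gamma>" using t True by (intro \<Gamma>) auto
    also have "\<dots> \<le> 2 * (\<Gamma> + A) * exp (C * (h + (t - t0)))"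
    proof -
      have "2 * (\<Gamma> + A) \<le> 2 * (\<Gamma> + A) * exp (C * (h + (t - t0)))"
        using \<Gamma>0 A0 C1 t by (intro le_mult_exp mult_nonneg_nonneg) auto
      then show ?thesis by (rule order_trans[rotated]) (use \<Gamma>0 A0 in simp)
    qed
    also have "\<dots> = B * exp (C * (t - t0))" unfolding B by (simp add: distrib_left exp_add)
    finally show ?thesis using True by (simp add: step_y_initial)
  next
    case False
    then have t0t: "t0 \<le> t" and tT: "t \<le> T" using t by auto
    have "norm (step_y g v e t - step_y g v e t0) \<le> (A + 2 * Lf * B) / C * exp (C * (t - t0))"
    proof (rule derivative_exp_bound[OF t0t co[OF tT]])
      fix s assume s: "t0 < s" "s < t"
      show "(step_y g v e has_vector_derivative f (s, v s, v (s - clip (e s)))) (at s)"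
        using dr s tT by auto
      have "A \<le> A * exp (C * (s - t0))"
        using A0 C1 s by (intro le_mult_exp) auto
      then show "norm (f (s, v s, v (s - clip (e s)))) \<le> (A + 2 * Lf * B) * exp (C * (s - t0))"
        using F[of s] s tT by (simp add: algebra_simps)
    qed (use A0 B0 C1 Lf_nonneg in auto)
    \<comment> \<open>Here the choice \<open>C = 4 * Lf + 1\<close> pays off:
      \<open>2 * Lf * B\<close> is at most \<open>C * B / 2\<close>, and \<open>A\<close> at most
      \<open>A * C\<close>.\<close>
    also have "\<dots> \<le> (A + B / 2) * exp (C * (t - t0))"
    proof (rule mult_right_mono)
      have "A \<le> A * C" using A0 C1 mult_left_mono[of 1 C A] by simp
      moreover have "0 \<le> B * Lf" using B0 Lf_nonneg by simp
      ultimately have "A + 2 * Lf * B \<le> (A + B / 2) * C"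
        unfolding C using B0 by (simp add: algebra_simps)
      then show "(A + 2 * Lf * B) / C \<le> A + B / 2" using C1 by (simp add: pos_divide_le_eq)
    qed simp
    finally have 1: "norm (step_y g v e t - g t0) \<le> (A + B / 2) * exp (C * (t - t0))"
      by (simp add: step_y_initial)
    have "norm (g t0) \<le> \<Gamma>" using h_pos by (intro \<Gamma>) auto
    also have "\<dots> \<le> \<Gamma> * exp (C * (t - t0))"
      using \<Gamma>0 C1 t0t by (intro le_mult_exp) auto
    finally have "norm (step_y g v e t) \<le> (\<Gamma> + A + B / 2) * exp (C * (t - t0))"
      using 1 norm_triangle_sub[of "step_y g v e t" "g t0"] by (simp add: algebra_simps)
    also have "\<dots> \<le> B * exp (C * (t - t0))" using B' by (intro mult_right_mono) auto
    finally show ?thesis .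
  qed
  show "(A + 2 * Lf * (B * exp (C * (T - t0))))-lipschitz_on {t0..T} (step_y g v e)" if "t0 \<le> T"
  proof (rule derivative_bound_lipschitz[OF co])
    fix s assume s: "t0 < s" "s < T"
    show "(step_y g v e has_vector_derivative f (s, v s, v (s - clip (e s)))) (at s)"
      using dr s by auto
    have "B * exp (C * (s - t0)) \<le> B * exp (C * (T - t0))"
      using B0 C1 s by (intro mult_left_mono) auto
    then have "Lf * (B * exp (C * (s - t0))) \<le> Lf * (B * exp (C * (T - t0)))"
      using Lf_nonneg by (rule mult_left_mono)
    then show "norm (f (s, v s, v (s - clip (e s)))) \<le> A + 2 * Lf * (B * exp (C * (T - t0)))"
      using F[of s] s by simp
  qed (use A0 B0 Lf_nonneg in auto)
qed

lemma step_\<eta>_lipschitz: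
  fixes g :: "real \<Rightarrow> real^'m"
  assumes "continuous_on {t0 - h..} v" "continuous_on {t0..} e" "continuous_on {t0 - h..t0} g"
  shows "(2 * (\<mu> * etat))-lipschitz_on {t0..T} (step_\<eta> e0 v e)"
proof -
  note dr = driven_step[OF assms, of T e0, unfolded driven_def]
  show ?thesis
  proof (rule derivative_bound_lipschitz)
    fix s assume s: "t0 < s" "s < T"
    show "(step_\<eta> e0 v e has_vector_derivative - \<mu> * (clip (e s) - etat) + G (v s)) (at s)"
      using dr s unfolding has_real_derivative_iff_has_vector_derivative by auto
    have "\<bar>clip (e s) - etat\<bar> \<le> etat" using clip_in[of "e s"] h_eq by auto
    then have "\<bar>\<mu> * (clip (e s) - etat)\<bar> \<le> \<mu> * etat"
      using mu_nonneg by (simp add: abs_mult mult_left_mono)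
    then show "norm (- \<mu> * (clip (e s) - etat) + G (v s)) \<le> 2 * (\<mu> * etat)"
      using G_bound[of "v s"] by auto
  qed (use dr mu_nonneg etat_pos in auto)
qed

section \<open>Convergence of the Picard iterates to a fixed point\<close>

primrec picard :: "(real \<Rightarrow> real^'m) \<Rightarrow> real \<Rightarrow> nat \<Rightarrow> (real \<Rightarrow> real^'m) \<times> (real \<Rightarrow> real)" where
  "picard g e0 0 = (\<lambda>t. g (min t t0), \<lambda>_. e0)"
| "picard g e0 (Suc k) = (step_y g (fst (picard g e0 k)) (snd (picard g e0 k)),
     step_\<eta> e0 (fst (picard g e0 k)) (snd (picard g e0 k)))"

definition picard_y_limit :: "(real \<Rightarrow> real^'m) \<Rightarrow> real \<Rightarrow> real \<Rightarrow> real^'m" where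
  "picard_y_limit g e0 t = lim (\<lambda>k. fst (picard g e0 k) t)"

definition picard_\<eta>_limit :: "(real \<Rightarrow> real^'m) \<Rightarrow> real \<Rightarrow> real \<Rightarrow> real" where
  "picard_\<eta>_limit g e0 t = lim (\<lambda>k. snd (picard g e0 k) t)"

context
  fixes g :: "real \<Rightarrow> real^'m" and e0 Lg :: real
  assumes g_lip: "Lg-lipschitz_on {t0 - h..t0} g"
begin

abbreviation "Y k \<equiv> fst (picard g e0 k)"
abbreviation "E k \<equiv> snd (picard g e0 k)"
abbreviation "Yl \<equiv> picard_y_limit g e0"
abbreviation "El \<equiv> picard_\<eta>_limit g e0"

lemma g_continuous: "continuous_on {t0 - h..t0} g"
  using g_lip by (rule lipschitz_on_continuous_on)

lemma picard_continuous: "continuous_on {t0 - h..} (Y k)" "continuous_on {t0..} (E k)"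
proof (induction k)
  case 0
  show "continuous_on {t0 - h..} (Y 0)"
    using h_pos by (auto intro!: continuous_on_compose2[OF g_continuous] continuous_intros)
  show "continuous_on {t0..} (E 0)" by simp
next
  case (Suc k)
  show "continuous_on {t0 - h..} (Y (Suc k))" "continuous_on {t0..} (E (Suc k))"
    using step_continuous[OF Suc g_continuous] by simp_all
qed

lemma picard_initial: "t \<le> t0 \<Longrightarrow> Y k t = g t" "E k t0 = e0"
  by (cases k; simp add: step_y_initial step_\<eta>_initial min_def)+

lemma driven_picard: "driven T (Y k) (\<lambda>t. clip (E k t)) (Y (Suc k)) (E (Suc k))"
  using driven_step[OF picard_continuous g_continuous] by simp

lemma picard_\<eta>_lipschitz: "(2 * (\<mu> * etat))-lipschitz_on {t0..T} (E k)"
proof (cases k)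
  case 0
  then show ?thesis using mu_nonneg etat_pos by (auto intro!: lipschitz_onI)
next
  case (Suc j)
  then show ?thesis using step_\<eta>_lipschitz[OF picard_continuous g_continuous] by simp
qed

text \<open>\<open>M\<close> has to be uniform in \<open>k\<close>, because the weight
  \<open>rate M\<close> must stay the same throughout the iteration. The growth bound is carried
  along by induction; it turns into a Lipschitz constant after \<open>t0\<close>, which is glued to
  the constant \<open>Lg\<close> of the history.\<close>

lemma picard_y_lipschitz:
  assumes "t0 \<le> T"
  shows "\<exists>M. \<forall>k. M-lipschitz_on {t0 - h..T} (Y k)"
proof -
  obtain \<Gamma> where \<Gamma>: "\<And>t. t \<in> {t0 - h..t0} \<Longrightarrow> norm (g t) \<le> \<Gamma>" "\<Gamma> > 0"
    using compact_imp_bounded[OF compact_continuous_image[OF g_continuous compact_Icc]]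
    unfolding bounded_pos by blast
  define A where A: "A = norm (f 0) + Lf * (\<bar>t0\<bar> + \<bar>T\<bar>)"
  define C where C: "C = 4 * Lf + 1"
  define B where B: "B = 2 * (\<Gamma> + A) * exp (C * h)"
  define M where "M = A + 2 * Lf * (B * exp (C * (T - t0)))"
  have A0: "A \<ge> 0" "C \<ge> 0" unfolding A C using Lf_nonneg by simp_all
  have "B \<ge> 0" unfolding B using A0 \<Gamma> by simp
  then have M0: "M \<ge> 0" unfolding M_def using A0 Lf_nonneg by simp
  have bd: "norm (Y k t) \<le> B * exp (C * (t - t0))" if "t \<in> {t0 - h..T}" for k t
    using that
  proof (induction k arbitrary: t)
    case 0
    have "norm (Y 0 t) \<le> \<Gamma>" using 0 h_pos \<Gamma>(1)[of "min t t0"] by simp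
    also have "\<Gamma> \<le> 2 * (\<Gamma> + A) * exp (C * (h + (t - t0)))"
    proof -
      have "0 \<le> C * (h + (t - t0))" using A0 0 by auto
      then have "2 * (\<Gamma> + A) \<le> 2 * (\<Gamma> + A) * exp (C * (h + (t - t0)))"
        using \<Gamma>(2) A0 by (intro le_mult_exp) auto
      then show ?thesis by (rule order_trans[rotated]) (use \<Gamma>(2) A0 in simp)
    qed
    also have "\<dots> = B * exp (C * (t - t0))" unfolding B by (simp add: distrib_left exp_add)
    finally show ?case .
  next
    case (Suc k)
    then show ?case
      using step_growth(1)[OF picard_continuous g_continuous \<Gamma>(1) A C B Suc.IH] by simp
  qed
  have "M-lipschitz_on {t0..T} (Y k)" for k
  proof (cases k)
    case 0
    have "0-lipschitz_on {t0..T} (Y 0)" by (auto intro!: lipschitz_onI simp: min_def)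
    then show ?thesis unfolding 0 using M0 by (auto intro: lipschitz_on_mono)
  next
    case (Suc j)
    then show ?thesis
      using step_growth(2)[OF picard_continuous g_continuous \<Gamma>(1) A C B bd assms]
      unfolding M_def by simp
  qed
  moreover have "Lg-lipschitz_on {t0 - h..t0} (Y k)" for k
    using g_lip by (rule lipschitz_on_transform) (simp add: picard_initial)
  ultimately show ?thesis by (intro exI[of _ "max Lg M"] allI lipschitz_on_glue)
qed

lemma picard_contraction:
  assumes M: "\<And>k. M-lipschitz_on {t0 - h..T} (Y k)"
  shows "\<exists>N\<ge>0. \<forall>k. close_within T (rate M) (N / 2 ^ k) (Y (Suc k)) (E (Suc k)) (Y k) (E k)"
proof -
  note cont = picard_continuous
  have c: "continuous_on {t0 - h..T} (Y k)" "continuous_on {t0..T} (E k)" for k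
    by (auto intro: continuous_on_subset[OF cont(1)] continuous_on_subset[OF cont(2)])
  obtain N where N: "N \<ge> 0" "close_within T (rate M) N (Y (Suc 0)) (E (Suc 0)) (Y 0) (E 0)"
    using close_within_exists[OF c c] by blast
  have "close_within T (rate M) (N / 2 ^ k) (Y (Suc k)) (E (Suc k)) (Y k) (E k)" for k
  proof (induction k)
    case (Suc k)
    \<comment> \<open>All iterates agree at \<open>t0\<close>, so \<open>driven_diff\<close> applies
      with \<delta> equal to 0 and only the halving remains.\<close>
    have i: "norm (Y (Suc (Suc k)) t0 - Y (Suc k) t0) \<le> 0" "\<bar>E (Suc (Suc k)) t0 - E (Suc k) t0\<bar> \<le> 0"
      by (simp_all only: picard_initial(1)[OF order_refl] picard_initial(2)) auto
    have "0 \<le> N / 2 ^ k" using N by simp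
    note d = driven_diff[OF driven_picard driven_picard conjI[OF clip_in clip_in]
        M close_within_clip[OF Suc] this i]
    have "norm (Y (Suc (Suc k)) t - Y (Suc k) t) \<le> N / 2 ^ Suc k * exp (rate M * (t - t0))"
      if t: "t \<in> {t0 - h..T}" for t
    proof (cases "t \<le> t0")
      case True
      have "norm (Y (Suc (Suc k)) t - Y (Suc k) t) = 0"
        by (simp only: picard_initial(1)[OF True]) simp
      then show ?thesis using N by simp
    next
      case False
      then have "t \<in> {t0..T}" using t by simp
      then show ?thesis using d(1)[of t] by simp
    qed
    moreover have "\<bar>E (Suc (Suc k)) t - E (Suc k) t\<bar> \<le> N / 2 ^ Suc k * exp (rate M * (t - t0))"
      if t: "t \<in> {t0..T}" for t
      using d(2)[of t] t by simp
    ultimately show ?case unfolding close_within_def by blast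
  qed (use N in simp)
  with N(1) show ?thesis by blast
qed

lemma picard_converges:
  assumes M: "\<And>k. M-lipschitz_on {t0 - h..T} (Y k)"
  shows "\<exists>N\<ge>0. \<forall>k. close_within T (rate M) (N / 2 ^ k) Yl El (Y k) (E k)"
    and "t \<in> {t0 - h..T} \<Longrightarrow> (\<lambda>k. Y k t) \<longlonglongrightarrow> Yl t"
    and "t \<in> {t0..T} \<Longrightarrow> (\<lambda>k. E k t) \<longlonglongrightarrow> El t"
proof -
  from picard_contraction[OF M] obtain N where N: "N \<ge> 0"
    "\<And>k. close_within T (rate M) (N / 2 ^ k) (Y (Suc k)) (E (Suc k)) (Y k) (E k)" by blast
  have y: "norm (Y (Suc k) t - Y k t) \<le> (N * exp (rate M * (t - t0))) / 2 ^ k"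
    if "t \<in> {t0 - h..T}" for t k
    using N(2)[of k] that unfolding close_within_def by simp
  have e: "norm (E (Suc k) t - E k t) \<le> (N * exp (rate M * (t - t0))) / 2 ^ k"
    if "t \<in> {t0..T}" for t k
    using N(2)[of k] that unfolding close_within_def by simp
  show "(\<lambda>k. Y k t) \<longlonglongrightarrow> Yl t" if "t \<in> {t0 - h..T}"
    unfolding picard_y_limit_def using geometric_increments_converge(1)[OF y[OF that]] .
  show "(\<lambda>k. E k t) \<longlonglongrightarrow> El t" if "t \<in> {t0..T}"
    unfolding picard_\<eta>_limit_def using geometric_increments_converge(1)[OF e[OF that]] .
  have "norm (Yl t - Y k t) \<le> 2 * N / 2 ^ k * exp (rate M * (t - t0))" if "t \<in> {t0 - h..T}" for t k
    using geometric_increments_converge(2)[OF y[OF that], of k]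
    unfolding picard_y_limit_def by (simp add: mult.assoc)
  moreover have "\<bar>El t - E k t\<bar> \<le> 2 * N / 2 ^ k * exp (rate M * (t - t0))" if "t \<in> {t0..T}" for t k
    using geometric_increments_converge(2)[OF e[OF that], of k]
    unfolding picard_\<eta>_limit_def by (simp add: mult.assoc)
  ultimately have "close_within T (rate M) (2 * N / 2 ^ k) Yl El (Y k) (E k)" for k
    unfolding close_within_def by blast
  then show "\<exists>N\<ge>0. \<forall>k. close_within T (rate M) (N / 2 ^ k) Yl El (Y k) (E k)"
    using N(1) by (intro exI[of _ "2 * N"]) auto
qed

lemma picard_limit_continuous: "continuous_on {t0 - h..} Yl" "continuous_on {t0..} El"
proof -
  show "continuous_on {t0 - h..} Yl"
  proof (rule lipschitz_on_all_intervals_continuous)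
    fix T :: real
    \<comment> \<open>\<open>T\<close> may lie before \<open>t0\<close>, where
      \<open>picard_y_lipschitz\<close> is silent; hence the maximum.\<close>
    obtain M where M: "\<And>k. M-lipschitz_on {t0 - h..max t0 T} (Y k)"
      using picard_y_lipschitz[of "max t0 T"] by auto
    have "M-lipschitz_on {t0 - h..max t0 T} Yl"
      by (rule lipschitz_on_pointwise_limit[OF M picard_converges(2)[OF M]])
    then have "M-lipschitz_on {t0 - h..T} Yl" by (rule lipschitz_on_subset) auto
    then show "\<exists>M. M-lipschitz_on {t0 - h..T} Yl" ..
  qed
  show "continuous_on {t0..} El"
  proof (rule lipschitz_on_all_intervals_continuous)
    fix T assume "t0 \<le> T"
    then obtain M where M: "\<And>k. M-lipschitz_on {t0 - h..T} (Y k)"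
      using picard_y_lipschitz by blast
    have "(2 * (\<mu> * etat))-lipschitz_on {t0..T} El"
      by (rule lipschitz_on_pointwise_limit[OF picard_\<eta>_lipschitz picard_converges(3)[OF M]])
    then show "\<exists>M. M-lipschitz_on {t0..T} El" ..
  qed
qed

text \<open>No limit is exchanged with an integral: by \<open>driven_diff\<close>, one step applied
  to the limit and one applied to iterate \<open>k\<close> differ by at most half the bound on the
  distance of their inputs. So iterate \<open>Suc k\<close> converges to the step of the limit as
  well as to the limit.\<close>

lemma picard_limit_fixed_point:
  assumes "t \<ge> t0"
  shows "step_y g Yl El t = Yl t" "step_\<eta> e0 Yl El t = El t"
proof -
  obtain M where M: "\<And>k. M-lipschitz_on {t0 - h..t} (Y k)"
    using picard_y_lipschitz[OF assms] by blast
  have tt: "t \<in> {t0 - h..t}" "t \<in> {t0..t}" using assms h_pos by auto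
  from picard_converges(1)[OF M] obtain N where N: "N \<ge> 0"
    "\<And>k. close_within t (rate M) (N / 2 ^ k) Yl El (Y k) (E k)" by blast
  define B where "B = N / 2 * exp (rate M * (t - t0))"
  have b: "norm (step_y g Yl El t - Y (Suc k) t) \<le> B * (1 / 2) ^ k"
    "norm (step_\<eta> e0 Yl El t - E (Suc k) t) \<le> B * (1 / 2) ^ k" for k
  proof -
    have i: "norm (step_y g Yl El t0 - Y (Suc k) t0) \<le> 0" "\<bar>step_\<eta> e0 Yl El t0 - E (Suc k) t0\<bar> \<le> 0"
      by (simp_all only: picard_initial(1)[OF order_refl] picard_initial(2) step_\<eta>_initial step_y_initial[OF order_refl]) auto
    have "0 \<le> N / 2 ^ k" using N by simp
    note d = driven_diff[OF driven_step[OF picard_limit_continuous g_continuous]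
        driven_picard conjI[OF clip_in clip_in] M close_within_clip[OF N(2)] this i tt(2)]
    show "norm (step_y g Yl El t - Y (Suc k) t) \<le> B * (1 / 2) ^ k"
      using d(1) unfolding B_def by (simp add: power_divide mult.commute)
    show "norm (step_\<eta> e0 Yl El t - E (Suc k) t) \<le> B * (1 / 2) ^ k"
      using d(2) unfolding B_def by (simp add: power_divide mult.commute)
  qed
  have z: "(\<lambda>k. B * (1 / 2) ^ k) \<longlonglongrightarrow> 0"
    by (intro tendsto_mult_right_zero LIMSEQ_power_zero) simp
  have "(\<lambda>k. Y (Suc k) t) \<longlonglongrightarrow> step_y g Yl El t" "(\<lambda>k. E (Suc k) t) \<longlonglongrightarrow> step_\<eta> e0 Yl El t"
    unfolding LIM_zero_iff[symmetric, where l="step_y g Yl El t"] LIM_zero_iff[symmetric, where l="step_\<eta> e0 Yl El t"]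
    by (rule Lim_null_comparison[OF _ z]; use b in \<open>simp add: norm_minus_commute abs_minus_commute\<close>)+
  then show "step_y g Yl El t = Yl t" "step_\<eta> e0 Yl El t = El t"
    using LIMSEQ_Suc[OF picard_converges(2)[OF M tt(1)]] LIMSEQ_Suc[OF picard_converges(3)[OF M tt(2)]]
    by (metis LIMSEQ_unique)+
qed

end

lemma global_solution_exists:
  assumes g: "C1_on {t0 - h..t0} g" and e0: "e0 \<in> {0..h}"
  shows "\<exists>y \<eta>. global_solution f G \<mu> etat h t0 g e0 y \<eta>"
proof -
  obtain Lg where Lg: "Lg-lipschitz_on {t0 - h..t0} g" using C1_on_imp_lipschitz[OF g] by blast
  define y where "y = picard_y_limit g e0"
  define \<eta> where "\<eta> = picard_\<eta>_limit g e0"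
  have cy: "continuous_on {t0 - h..} y" and c\<eta>: "continuous_on {t0..} \<eta>"
    unfolding y_def \<eta>_def using picard_limit_continuous[OF Lg] by auto
  have fy: "step_y g y \<eta> t = y t" and f\<eta>: "step_\<eta> e0 y \<eta> t = \<eta> t" if "t \<ge> t0" for t
    unfolding y_def \<eta>_def using picard_limit_fixed_point[OF Lg that] by auto
  have yg: "y t = g t" if "t \<in> {t0 - h..t0}" for t
  proof -
    have "fst (picard g e0 k) t = g t" for k using picard_initial(1)[OF Lg] that by simp
    then show ?thesis unfolding y_def picard_y_limit_def by (simp add: limI)
  qed
  have dy: "(y has_vector_derivative f (t, y t, y (t - clip (\<eta> t)))) (at t within {t0..})"
    and d\<eta>: "(\<eta> has_real_derivative - \<mu> * (clip (\<eta> t) - etat) + G (y t)) (at t within {t0..})"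
    if "t \<ge> t0" for t
  proof -
    show "(y has_vector_derivative f (t, y t, y (t - clip (\<eta> t)))) (at t within {t0..})"
      by (rule has_vector_derivative_transform[OF _ _ step_derivative(1)[where g=g, OF cy c\<eta> that]])
        (use that fy in auto)
    show "(\<eta> has_real_derivative - \<mu> * (clip (\<eta> t) - etat) + G (y t)) (at t within {t0..})"
      unfolding has_real_derivative_iff_has_vector_derivative
      by (rule has_vector_derivative_transform[OF _ _
            step_derivative(2)[where ?e0.0 = e0, OF cy c\<eta> that, unfolded has_real_derivative_iff_has_vector_derivative]])
        (use that f\<eta> in auto)
  qed
  have at: "at t within {t0..} = at t" if "t > t0" for t
    using that by (intro at_within_interior) (auto simp: interior_real_atLeast)
  have \<eta>0: "\<eta> t0 = e0" using f\<eta>[of t0] by (simp add: step_\<eta>_initial)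
  have d\<eta>': "(\<eta> has_real_derivative - \<mu> * (clip (\<eta> t) - etat) + G (y t)) (at t)" if "t > t0" for t
    using d\<eta>[of t] at[OF that] that by simp
  \<comment> \<open>Here \<kappa> is the clipped delay, which equals 0 where \<eta> is negative and
    \<open>h\<close> where \<eta> exceeds \<open>h\<close>.\<close>
  have r: "\<eta> t \<in> {0..h}" if "t \<ge> t0" for t
    by (rule delay_stays_in_range[OF c\<eta> _ that d\<eta>'])
      (use e0 \<eta>0 in \<open>auto simp: clip_def\<close>)
  then have cl: "clip (\<eta> t) = \<eta> t" if "t \<ge> t0" for t using that by (force simp: clip_def)
  have "C1_on {t0..} y" unfolding C1_on_def
    by (intro exI[of _ "\<lambda>t. f (t, y t, y (t - clip (\<eta> t)))"] conjI clipped_continuous cy c\<eta>)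
      (use dy in auto)
  moreover have "C1_on {t0..} \<eta>" unfolding C1_on_def
    by (intro exI[of _ "\<lambda>t. - \<mu> * (clip (\<eta> t) - etat) + G (y t)"] conjI clipped_continuous cy c\<eta>)
      (use d\<eta> in \<open>auto simp: has_real_derivative_iff_has_vector_derivative[symmetric]\<close>)
  moreover have "\<forall>t>t0. t0 - h \<le> t - \<eta> t \<and>
        (y has_vector_derivative f (t, y t, y (t - \<eta> t))) (at t) \<and>
        (\<eta> has_real_derivative - \<mu> * (\<eta> t - etat) + G (y t)) (at t)"
  proof (intro allI impI)
    fix t assume t: "t > t0"
    have "(y has_vector_derivative f (t, y t, y (t - \<eta> t))) (at t)"
      using dy[of t] cl[of t] at[OF t] t by simp
    moreover have "(\<eta> has_real_derivative - \<mu> * (\<eta> t - etat) + G (y t)) (at t)"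
      using d\<eta>'[OF t] cl[of t] t by simp
    moreover have "t0 - h \<le> t - \<eta> t" using r[of t] t by simp
    ultimately show "t0 - h \<le> t - \<eta> t \<and>
        (y has_vector_derivative f (t, y t, y (t - \<eta> t))) (at t) \<and>
        (\<eta> has_real_derivative - \<mu> * (\<eta> t - etat) + G (y t)) (at t)" by blast
  qed
  ultimately have "global_solution f G \<mu> etat h t0 g e0 y \<eta>"
    unfolding global_solution_def using cy c\<eta> yg \<eta>0 by blast
  then show ?thesis by blast
qed

subsection \<open>Properties of global solutions\<close>

lemma global_solution_delay_range:
  assumes "global_solution f G \<mu> etat h t0 g e0 y \<eta>" "e0 \<in> {0..h}" "t \<ge> t0"
  shows "\<eta> t \<in> {0..h}"
  by (rule delay_stays_in_range[where \<kappa>=\<eta> and v=y])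
    (use assms in \<open>auto simp: global_solution_def\<close>)

lemma global_solution_derivative:
  assumes s: "global_solution f G \<mu> etat h t0 g e0 y \<eta>" and e0: "e0 \<in> {0..h}"
  shows "continuous_on {t0..} (\<lambda>t. f (t, y t, y (t - \<eta> t)))"
    and "continuous_on {t0..} (\<lambda>t. - \<mu> * (\<eta> t - etat) + G (y t))"
    and "t \<ge> t0 \<Longrightarrow> (y has_vector_derivative f (t, y t, y (t - \<eta> t))) (at t within {t0..})"
    and "t \<ge> t0 \<Longrightarrow> (\<eta> has_real_derivative - \<mu> * (\<eta> t - etat) + G (y t)) (at t within {t0..})"
proof -
  have c: "continuous_on {t0 - h..} y" "continuous_on {t0..} \<eta>"
    and C1: "C1_on {t0..} y" "C1_on {t0..} \<eta>"
    and d: "\<And>t. t > t0 \<Longrightarrow> (y has_vector_derivative f (t, y t, y (t - \<eta> t))) (at t)"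
      "\<And>t. t > t0 \<Longrightarrow> (\<eta> has_vector_derivative - \<mu> * (\<eta> t - etat) + G (y t)) (at t)"
    using s unfolding global_solution_def has_real_derivative_iff_has_vector_derivative by auto
  note F = delayed_continuous[OF c global_solution_delay_range[OF s e0]]
  show "continuous_on {t0..} (\<lambda>t. f (t, y t, y (t - \<eta> t)))"
    "continuous_on {t0..} (\<lambda>t. - \<mu> * (\<eta> t - etat) + G (y t))" using F by auto
  show "(y has_vector_derivative f (t, y t, y (t - \<eta> t))) (at t within {t0..})" if "t \<ge> t0"
    by (rule C1_on_derivative_at_left_endpoint[OF C1(1) F(1) d(1) that])
  show "(\<eta> has_real_derivative - \<mu> * (\<eta> t - etat) + G (y t)) (at t within {t0..})" if "t \<ge> t0"
    unfolding has_real_derivative_iff_has_vector_derivative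
    by (rule C1_on_derivative_at_left_endpoint[OF C1(2) F(2) d(2) that])
qed

lemma global_solution_lipschitz:
  assumes s: "global_solution f G \<mu> etat h t0 g e0 y \<eta>" and g: "C1_on {t0 - h..t0} g"
  shows "\<exists>M. M-lipschitz_on {t0 - h..T} y"
proof -
  have "C1_on {t0..T} y"
    using s unfolding global_solution_def by (auto intro: C1_on_subset)
  then obtain L where L: "L-lipschitz_on {t0..T} y" using C1_on_imp_lipschitz by blast
  obtain Lg where "Lg-lipschitz_on {t0 - h..t0} g" using C1_on_imp_lipschitz[OF g] by blast
  then have "Lg-lipschitz_on {t0 - h..t0} y"
    by (rule lipschitz_on_transform) (use s in \<open>auto simp: global_solution_def\<close>)
  from lipschitz_on_glue[OF this L] show ?thesis ..
qed

lemma driven_global_solution: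
  assumes "global_solution f G \<mu> etat h t0 g e0 y \<eta>"
  shows "driven T y \<eta> y \<eta>"
  using assms h_pos unfolding driven_def global_solution_def
  by (auto intro: continuous_on_subset)

text \<open>A solution is driven by itself, so \<open>driven_diff\<close> improves any valid
  constant \<open>N\<close> to \<open>D + N / 2\<close>; iterating leads to the fixed point
  \<open>2 * D\<close>. The factor \<open>exp (rate M * h)\<close> in \<open>D\<close> is needed
  because the weight may be that small at the left end of the history. For \<delta> equal to 0 the
  estimate expresses uniqueness on the interval.\<close>

lemma global_solution_stability:
  assumes s1: "global_solution f G \<mu> etat h t0 g1 e1 y1 \<eta>1" and e1: "e1 \<in> {0..h}"
    and s2: "global_solution f G \<mu> etat h t0 g2 e2 y2 \<eta>2" and e2: "e2 \<in> {0..h}"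
    and M: "M-lipschitz_on {t0 - h..T} y2"
    and \<delta>: "\<And>t. t \<in> {t0 - h..t0} \<Longrightarrow> norm (g1 t - g2 t) \<le> \<delta>" "\<bar>e1 - e2\<bar> \<le> \<delta>"
  shows "close_within T (rate M) (2 * (\<delta> * exp (rate M * h))) y1 \<eta>1 y2 \<eta>2"
proof -
  define D where "D = \<delta> * exp (rate M * h)"
  have \<delta>0: "\<delta> \<ge> 0" using order_trans[OF abs_ge_zero \<delta>(2)] .
  have D0: "D \<ge> 0" unfolding D_def using \<delta>0 by simp
  have K: "rate M > 0" using rate_pos[OF lipschitz_on_nonneg[OF M]] .
  have i: "y1 t = g1 t" "y2 t = g2 t" if "t \<in> {t0 - h..t0}" for t
    using s1 s2 that unfolding global_solution_def by auto
  have i\<eta>: "\<eta>1 t0 = e1" "\<eta>2 t0 = e2" using s1 s2 unfolding global_solution_def by auto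
  have \<delta>D: "\<delta> \<le> D * exp (rate M * (t - t0))" if "t \<in> {t0 - h..T}" for t
  proof -
    have "\<delta> \<le> \<delta> * exp (rate M * (h + (t - t0)))"
      using \<delta>0 K that by (intro le_mult_exp mult_nonneg_nonneg) auto
    then show ?thesis unfolding D_def by (simp add: distrib_left exp_add mult.assoc)
  qed
  have step: "close_within T (rate M) (D + N / 2) y1 \<eta>1 y2 \<eta>2"
    if N: "N \<ge> 0" "close_within T (rate M) N y1 \<eta>1 y2 \<eta>2" for N
  proof -
    have i0: "norm (y1 t0 - y2 t0) \<le> \<delta>" "\<bar>\<eta>1 t0 - \<eta>2 t0\<bar> \<le> \<delta>"
      using \<delta> i[of t0] i\<eta> h_pos by auto
    have r: "\<eta>1 t \<in> {0..h} \<and> \<eta>2 t \<in> {0..h}" if "t \<in> {t0..T}" for t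
      using global_solution_delay_range[OF s1 e1] global_solution_delay_range[OF s2 e2] that by simp
    note d = driven_diff[OF driven_global_solution[OF s1] driven_global_solution[OF s2] r M N(2,1) i0]
    have "norm (y1 t - y2 t) \<le> (D + N / 2) * exp (rate M * (t - t0))" if t: "t \<in> {t0 - h..T}" for t
    proof (cases "t \<le> t0")
      case True
      have "norm (y1 t - y2 t) \<le> \<delta>" using \<delta>(1)[of t] i[of t] t True by simp
      moreover have "0 \<le> N / 2 * exp (rate M * (t - t0))" using N(1) by simp
      ultimately show ?thesis using \<delta>D[OF t] unfolding distrib_right by linarith
    next
      case False
      then show ?thesis using d(1)[of t] \<delta>D[OF t] t by (simp add: distrib_right)
    qed
    moreover have "\<bar>\<eta>1 t - \<eta>2 t\<bar> \<le> (D + N / 2) * exp (rate M * (t - t0))" if t: "t \<in> {t0..T}" for t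
      using d(2)[of t] \<delta>D[of t] t h_pos by (simp add: distrib_right)
    ultimately show ?thesis unfolding close_within_def by blast
  qed
  have "continuous_on {t0 - h..T} y1" "continuous_on {t0..T} \<eta>1"
    "continuous_on {t0 - h..T} y2" "continuous_on {t0..T} \<eta>2"
    using s1 s2 unfolding global_solution_def by (auto intro: continuous_on_subset)
  from close_within_exists[OF this, of "rate M"] obtain N0 where
    N0: "N0 \<ge> 0" "close_within T (rate M) N0 y1 \<eta>1 y2 \<eta>2" by blast
  \<comment> \<open>The closed form of the recursion \<open>N\<close> to \<open>D + N / 2\<close>
    started at \<open>N0\<close>.\<close>
  have it: "2 * D + (N0 - 2 * D) * (1 / 2) ^ k \<ge> 0 \<and>
      close_within T (rate M) (2 * D + (N0 - 2 * D) * (1 / 2) ^ k) y1 \<eta>1 y2 \<eta>2" for k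
  proof (induction k)
    case (Suc k)
    have eq: "D + (2 * D + (N0 - 2 * D) * (1 / 2) ^ k) / 2 = 2 * D + (N0 - 2 * D) * (1 / 2) ^ Suc k"
      by (simp add: field_simps)
    show ?case using Suc step[of "2 * D + (N0 - 2 * D) * (1 / 2) ^ k"] D0
      unfolding eq[symmetric] by auto
  qed (use N0 in auto)
  have lim: "(\<lambda>k. (2 * D + (N0 - 2 * D) * (1 / 2) ^ k) * x) \<longlonglongrightarrow> (2 * D + (N0 - 2 * D) * 0) * x" for x
    by (intro tendsto_intros LIMSEQ_power_zero) simp
  show ?thesis unfolding close_within_def D_def[symmetric]
  proof (intro conjI ballI)
    fix t assume "t \<in> {t0 - h..T}"
    then have "norm (y1 t - y2 t) \<le> (2 * D + (N0 - 2 * D) * (1 / 2) ^ k) * exp (rate M * (t - t0))" for k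
      using it[of k] unfolding close_within_def by blast
    then show "norm (y1 t - y2 t) \<le> 2 * D * exp (rate M * (t - t0))"
      using LIMSEQ_le_const[OF lim[of "exp (rate M * (t - t0))"]] by simp
  next
    fix t assume "t \<in> {t0..T}"
    then have "\<bar>\<eta>1 t - \<eta>2 t\<bar> \<le> (2 * D + (N0 - 2 * D) * (1 / 2) ^ k) * exp (rate M * (t - t0))" for k
      using it[of k] unfolding close_within_def by blast
    then show "\<bar>\<eta>1 t - \<eta>2 t\<bar> \<le> 2 * D * exp (rate M * (t - t0))"
      using LIMSEQ_le_const[OF lim[of "exp (rate M * (t - t0))"]] by simp
  qed
qed

text \<open>The limit solution takes the place of \<open>y2\<close> in the stability estimate. Its
  Lipschitz constant \<open>M\<close> does not depend on \<open>n\<close>, so the error is \<delta>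
  times a fixed factor.\<close>

lemma global_solution_continuous_dependence:
  assumes sb: "global_solution f G \<mu> etat h t0 gb eb yb \<eta>b" and eb: "eb \<in> {0..h}"
    and sn: "\<And>n. global_solution f G \<mu> etat h t0 (g n) (e n) (y n) (\<eta> n)" and en: "\<And>n. e n \<in> {0..h}"
    and gb: "C1_on {t0 - h..t0} gb"
    and \<delta>: "\<And>n t. t \<in> {t0 - h..t0} \<Longrightarrow> norm (g n t - gb t) \<le> \<delta> n" "\<And>n. \<bar>e n - eb\<bar> \<le> \<delta> n"
    and \<delta>0: "\<delta> \<longlonglongrightarrow> 0" and "\<epsilon> > 0"
  shows "eventually (\<lambda>n. (\<forall>t\<in>{t0 - h..T}. norm (y n t - yb t) \<le> \<epsilon>) \<and>
    (\<forall>t\<in>{t0..T}. \<bar>\<eta> n t - \<eta>b t\<bar> \<le> \<epsilon>)) sequentially"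
proof -
  obtain M where M: "M-lipschitz_on {t0 - h..T} yb" using global_solution_lipschitz[OF sb gb] by blast
  have K: "rate M > 0" using rate_pos[OF lipschitz_on_nonneg[OF M]] .
  have "(\<lambda>n. 2 * (\<delta> n * exp (rate M * h)) * exp (rate M * (T - t0))) \<longlonglongrightarrow>
    2 * (0 * exp (rate M * h)) * exp (rate M * (T - t0))"
    by (intro tendsto_intros \<delta>0)
  moreover have "2 * (0 * exp (rate M * h)) * exp (rate M * (T - t0)) < \<epsilon>" using \<open>\<epsilon> > 0\<close> by simp
  ultimately have "eventually (\<lambda>n. 2 * (\<delta> n * exp (rate M * h)) * exp (rate M * (T - t0)) < \<epsilon>) sequentially"
    by (rule order_tendstoD(2))
  then show ?thesis
  proof eventually_elim
    case (elim n)
    have "\<delta> n \<ge> 0" using order_trans[OF abs_ge_zero \<delta>(2)] .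
    then have *: "2 * (\<delta> n * exp (rate M * h)) * exp (rate M * (t - t0)) \<le> \<epsilon>" if "t \<le> T" for t
    proof -
      have "2 * (\<delta> n * exp (rate M * h)) * exp (rate M * (t - t0)) \<le>
        2 * (\<delta> n * exp (rate M * h)) * exp (rate M * (T - t0))"
        using \<open>\<delta> n \<ge> 0\<close> K that by (intro mult_left_mono) auto
      with elim show ?thesis by linarith
    qed
    show ?case using global_solution_stability[OF sn en sb eb M \<delta>] *
      unfolding close_within_def by (meson atLeastAtMost_iff order_trans)
  qed
qed

text \<open>The derivative is \<open>1 + \<mu> * \<eta> t - \<mu> * etat - G (y t)\<close>. The
  second summand is nonnegative, and each of the last two costs at most
  \<open>\<mu> * etat\<close>.\<close>

lemma deviating_argument_derivative:
  assumes s: "global_solution f G \<mu> etat h t0 g e0 y \<eta>" and e0: "e0 \<in> {0..h}" and t: "t \<ge> t0"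
  shows "((\<lambda>t. t - \<eta> t) has_real_derivative 1 - (- \<mu> * (\<eta> t - etat) + G (y t))) (at t within {t0..})"
    and "1 - 2 * (\<mu> * etat) \<le> 1 - (- \<mu> * (\<eta> t - etat) + G (y t))"
proof -
  show "((\<lambda>t. t - \<eta> t) has_real_derivative 1 - (- \<mu> * (\<eta> t - etat) + G (y t))) (at t within {t0..})"
    by (auto intro!: derivative_eq_intros global_solution_derivative(4)[OF s e0 t])
  have "0 \<le> \<mu> * \<eta> t" using global_solution_delay_range[OF s e0 t] mu_nonneg by simp
  then show "1 - 2 * (\<mu> * etat) \<le> 1 - (- \<mu> * (\<eta> t - etat) + G (y t))"
    using G_bound[of "y t"] by (simp add: algebra_simps)
qed

end
subsection \<open>The time transformation\<close>

text \<open>Isolates the part of the argument that sees the delay system only through \<sigma>. The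
  condition at the left end encodes \<open>\<omega> (s0 - h) = t0 - \<eta> t0\<close>, which makes
  \<omega> fit together with the inverse of \<sigma> at \<open>s0\<close>.\<close>

locale time_change =
  fixes \<sigma> \<sigma>' \<omega> :: "real \<Rightarrow> real" and t0 s0 h c :: real
  assumes h_pos: "h > 0" and c_pos: "c > 0"
    and \<sigma>_derivative: "t \<ge> t0 \<Longrightarrow> (\<sigma> has_real_derivative \<sigma>' t) (at t within {t0..})"
    and \<sigma>'_ge: "t \<ge> t0 \<Longrightarrow> c \<le> \<sigma>' t" and \<sigma>'_continuous: "continuous_on {t0..} \<sigma>'"
    and \<omega>_C1: "C1_on {s0 - h..s0} \<omega>"
    and \<omega>_derivative: "s \<in> {s0 - h..s0} \<Longrightarrow>
      \<exists>d>0. (\<omega> has_real_derivative d) (at s within {s0 - h..s0})"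
    and \<omega>_right: "\<omega> s0 = t0" and \<omega>_left: "\<omega> (s0 - h) = \<sigma> t0"
begin

section \<open>The deviating argument and its inverse\<close>

lemma \<sigma>_continuous: "continuous_on {t0..} \<sigma>"
  using \<sigma>_derivative by (intro DERIV_continuous_on) auto

lemma \<sigma>_expands:
  assumes "t0 \<le> a" "a \<le> b"
  shows "c * (b - a) \<le> \<sigma> b - \<sigma> a"
proof -
  have "\<sigma> a - c * a \<le> \<sigma> b - c * b"
  proof (rule DERIV_nonneg_imp_increasing_open[OF assms(2)])
    show "continuous_on {a..b} (\<lambda>t. \<sigma> t - c * t)"
      using assms by (intro continuous_intros continuous_on_subset[OF \<sigma>_continuous]) auto
    fix t assume t: "a < t" "t < b"
    then have "at t within {t0..} = at t"
      using assms by (intro at_within_interior) (auto simp: interior_real_atLeast)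
    then have "((\<lambda>t. \<sigma> t - c * t) has_real_derivative \<sigma>' t - c) (at t)"
      using \<sigma>_derivative[of t] t assms by (auto intro!: derivative_eq_intros)
    moreover have "0 \<le> \<sigma>' t - c" using \<sigma>'_ge[of t] t assms by simp
    ultimately show "\<exists>D. ((\<lambda>t. \<sigma> t - c * t) has_real_derivative D) (at t) \<and> 0 \<le> D" by blast
  qed
  then show ?thesis by (simp add: algebra_simps)
qed

lemma \<sigma>_expands_abs:
  assumes "t0 \<le> a" "t0 \<le> b"
  shows "c * \<bar>a - b\<bar> \<le> \<bar>\<sigma> a - \<sigma> b\<bar>"
  using \<sigma>_expands[of a b] \<sigma>_expands[of b a] assms by (cases "a \<le> b") auto

lemma \<sigma>_inj: "inj_on \<sigma> {t0..}"
proof (rule inj_onI)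
  fix a b assume "a \<in> {t0..}" "b \<in> {t0..}" "\<sigma> a = \<sigma> b"
  then have "c * \<bar>a - b\<bar> \<le> 0" using \<sigma>_expands_abs[of a b] by simp
  then show "a = b" using c_pos by (simp add: mult_le_0_iff)
qed

lemma \<sigma>_range: "\<sigma> ` {t0..} = {\<sigma> t0..}"
proof (intro equalityI subsetI)
  fix u assume "u \<in> \<sigma> ` {t0..}"
  then obtain t where t: "t \<ge> t0" "u = \<sigma> t" by auto
  have "0 \<le> c * (t - t0)" using t c_pos by simp
  then show "u \<in> {\<sigma> t0..}" using \<sigma>_expands[of t0 t] t by simp
next
  fix u assume u: "u \<in> {\<sigma> t0..}"
  \<comment> \<open>Chosen so that growth at slope \<open>c\<close> from \<open>t0\<close> reaches
    exactly \<open>u\<close> at \<open>b\<close>; as \<sigma> grows at least that fast, the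
    intermediate value theorem applies on \<open>[t0, b]\<close>.\<close>
  define b where "b = t0 + (u - \<sigma> t0) / c"
  have b: "t0 \<le> b" unfolding b_def using u c_pos by simp
  have "u \<le> \<sigma> b" using \<sigma>_expands[OF order_refl b] c_pos unfolding b_def by simp
  moreover have "continuous_on {t0..b} \<sigma>" using \<sigma>_continuous by (rule continuous_on_subset) auto
  ultimately obtain t where "t0 \<le> t" "\<sigma> t = u" using IVT'[of \<sigma> t0 u b] u b by auto
  then show "u \<in> \<sigma> ` {t0..}" by auto
qed

definition \<sigma>_inv :: "real \<Rightarrow> real" where "\<sigma>_inv = the_inv_into {t0..} \<sigma>"

lemma \<sigma>_inv:
  assumes "u \<ge> \<sigma> t0"
  shows "\<sigma>_inv u \<ge> t0" "\<sigma> (\<sigma>_inv u) = u"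
proof -
  have "u \<in> \<sigma> ` {t0..}" using assms \<sigma>_range by auto
  then show "\<sigma>_inv u \<ge> t0" "\<sigma> (\<sigma>_inv u) = u"
    unfolding \<sigma>_inv_def using the_inv_into_into[OF \<sigma>_inj _ subset_refl, of u] f_the_inv_into_f[OF \<sigma>_inj, of u] by auto
qed

lemma \<sigma>_inv_t0: "\<sigma>_inv (\<sigma> t0) = t0"
  unfolding \<sigma>_inv_def by (rule the_inv_into_f_f[OF \<sigma>_inj]) simp

lemma \<sigma>_inv_lipschitz: "(1 / c)-lipschitz_on {\<sigma> t0..} \<sigma>_inv"
proof (rule lipschitz_onI)
  fix u v assume "u \<in> {\<sigma> t0..}" "v \<in> {\<sigma> t0..}"
  then have "c * \<bar>\<sigma>_inv u - \<sigma>_inv v\<bar> \<le> \<bar>u - v\<bar>"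
    using \<sigma>_expands_abs[of "\<sigma>_inv u" "\<sigma>_inv v"] \<sigma>_inv[of u] \<sigma>_inv[of v] by simp
  then show "dist (\<sigma>_inv u) (\<sigma>_inv v) \<le> 1 / c * dist u v"
    using c_pos by (simp add: dist_real_def field_simps)
qed (use c_pos in auto)

text \<open>The difference quotient of the inverse at \<open>v\<close> is the reciprocal of that of
  \<sigma> at \<open>\<sigma>_inv v\<close>. The substitution is legitimate because the inverse is
  continuous and takes the value \<open>?x\<close> only at \<open>u\<close>. Working with filters
  within half-lines includes the endpoint \<open>\<sigma> t0\<close>.\<close>

lemma \<sigma>_inv_derivative:
  assumes u: "u \<ge> \<sigma> t0"
  shows "(\<sigma>_inv has_real_derivative 1 / \<sigma>' (\<sigma>_inv u)) (at u within {\<sigma> t0..})"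
proof -
  let ?x = "\<sigma>_inv u"
  have x: "?x \<ge> t0" "\<sigma> ?x = u" using \<sigma>_inv[OF u] .
  have ne: "\<sigma>_inv v \<noteq> ?x" if "v \<ge> \<sigma> t0" "v \<noteq> u" for v
    using \<sigma>_inv(2)[OF that(1)] x(2) that(2) by metis
  have "(\<sigma>_inv \<longlongrightarrow> ?x) (at u within {\<sigma> t0..})"
    using lipschitz_on_continuous_on[OF \<sigma>_inv_lipschitz] u by (auto simp: continuous_on_def)
  moreover have "eventually (\<lambda>v. \<sigma>_inv v \<in> {t0..} \<and> \<sigma>_inv v \<noteq> ?x) (at u within {\<sigma> t0..})"
    using \<sigma>_inv(1) ne by (auto simp: eventually_at_filter)
  ultimately have fl: "filterlim \<sigma>_inv (at ?x within {t0..}) (at u within {\<sigma> t0..})"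
    by (simp add: filterlim_at)
  have "((\<lambda>t. (\<sigma> t - \<sigma> ?x) / (t - ?x)) \<longlongrightarrow> \<sigma>' ?x) (at ?x within {t0..})"
    using \<sigma>_derivative[OF x(1)] unfolding has_field_derivative_iff .
  from tendsto_inverse[OF filterlim_compose[OF this fl]]
  have "((\<lambda>v. inverse ((\<sigma> (\<sigma>_inv v) - \<sigma> ?x) / (\<sigma>_inv v - ?x))) \<longlongrightarrow> inverse (\<sigma>' ?x)) (at u within {\<sigma> t0..})"
    using \<sigma>'_ge[OF x(1)] c_pos by auto
  moreover have "eventually (\<lambda>v. inverse ((\<sigma> (\<sigma>_inv v) - \<sigma> ?x) / (\<sigma>_inv v - ?x)) = (\<sigma>_inv v - ?x) / (v - u))
      (at u within {\<sigma> t0..})"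
    using \<sigma>_inv(2) x(2) by (auto simp: eventually_at_filter)
  ultimately show ?thesis
    unfolding has_field_derivative_iff by (simp add: inverse_eq_divide Lim_transform_eventually)
qed

section \<open>Existence of the time transformation\<close>

lemma \<omega>_strict_mono:
  assumes "s0 - h \<le> a" "a < b" "b \<le> s0"
  shows "\<omega> a < \<omega> b"
proof (rule DERIV_pos_imp_increasing_open[OF assms(2)])
  show "continuous_on {a..b} \<omega>"
    using assms by (intro continuous_on_subset[OF C1_on_imp_continuous_on[OF \<omega>_C1]]) auto
  fix s assume "a < s" "s < b"
  then show "\<exists>d. (\<omega> has_real_derivative d) (at s) \<and> d > 0"
    using \<omega>_derivative[of s] at_within_Icc_at[of "s0 - h" s s0] assms by auto
qed

lemma \<omega>_range: "s \<in> {s0 - h..s0} \<Longrightarrow> \<sigma> t0 \<le> \<omega> s \<and> \<omega> s \<le> t0"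
  using \<omega>_strict_mono[of "s0 - h" s] \<omega>_strict_mono[of s s0] \<omega>_left \<omega>_right
  by (cases "s = s0 - h"; cases "s = s0") auto

lemma \<sigma>_t0_less: "\<sigma> t0 < t0"
  using \<omega>_strict_mono[of "s0 - h" s0] h_pos \<omega>_left \<omega>_right by simp

text \<open>The definition takes the delay as its argument, so \<sigma> enters as the delay
  \<open>t - \<sigma> t\<close>. Membership in the range of \<sigma> reduces to an inequality
  because that range is a half-line.\<close>

lemma time_transformation_iff:
  "time_transformation t0 s0 h (\<lambda>t. t - \<sigma> t) \<omega> \<alpha> \<longleftrightarrow>
    (\<forall>s\<in>{s0 - h..s0}. \<alpha> s = \<omega> s) \<and> (\<forall>s\<ge>s0. \<sigma> t0 \<le> \<alpha> (s - h) \<and> \<alpha> s = \<sigma>_inv (\<alpha> (s - h)))"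
proof -
  have "\<forall>t\<ge>t0. \<exists>d>0. (\<sigma> has_real_derivative d) (at t within {t0..})"
    using \<sigma>_derivative \<sigma>'_ge c_pos by (meson less_le_trans)
  then show ?thesis
    unfolding time_transformation_def Let_def by (simp add: \<sigma>_range \<sigma>_inv_def)
qed

text \<open>The stepwise construction in closed form: \<open>k s\<close> steps of length
  \<open>h\<close> lead from \<open>s\<close> back into \<open>[s0 - h, s0)\<close>, and the inverse
  of \<sigma> is applied as many times to the value of \<omega> found there. That \<alpha> never
  falls below \<open>\<sigma> t0\<close> follows by induction on the number of steps.\<close>

lemma time_transformation_exists: "\<exists>\<alpha>. time_transformation t0 s0 h (\<lambda>t. t - \<sigma> t) \<omega> \<alpha>"
proof -
  define k where "k s = nat (\<lfloor>(s - s0) / h\<rfloor> + 1)" for s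
  define \<alpha> where "\<alpha> s = (\<sigma>_inv ^^ k s) (\<omega> (s - real (k s) * h))" for s
  have kS: "k s = Suc (k (s - h))" if "s \<ge> s0" for s
  proof -
    have "(s - s0) / h = (s - h - s0) / h + 1" using h_pos by (simp add: field_simps)
    then have "\<lfloor>(s - s0) / h\<rfloor> = \<lfloor>(s - h - s0) / h\<rfloor> + 1" by simp
    moreover have "0 \<le> \<lfloor>(s - s0) / h\<rfloor>" using that h_pos by simp
    ultimately show ?thesis unfolding k_def by simp
  qed
  have k0: "k s = 0" if "s < s0" for s
  proof -
    have "(s - s0) / h < 0" using that h_pos by (simp add: divide_neg_pos)
    then show ?thesis unfolding k_def by linarith
  qed
  have step: "\<alpha> s = \<sigma>_inv (\<alpha> (s - h))" if "s \<ge> s0" for s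
    unfolding \<alpha>_def kS[OF that] by (simp add: algebra_simps)
  have init: "\<alpha> s = \<omega> s" if s: "s \<in> {s0 - h..s0}" for s
  proof (cases "s = s0")
    \<comment> \<open>At \<open>s0\<close> the count is already 1, so the formula does not read off
      \<open>\<omega> s0\<close> but inverts \<sigma> at
      \<open>\<omega> (s0 - h) = \<sigma> t0\<close>; the result \<open>t0\<close> agrees with
      \<open>\<omega> s0\<close>.\<close>
    case True
    have "\<alpha> (s0 - h) = \<omega> (s0 - h)" unfolding \<alpha>_def using k0[of "s0 - h"] h_pos by simp
    then show ?thesis using step[of s0] True \<sigma>_inv_t0 \<omega>_left \<omega>_right by simp
  next
    case False
    then show ?thesis unfolding \<alpha>_def using k0[of s] s by simp
  qed
  have ge: "\<sigma> t0 \<le> \<alpha> s" if "s \<ge> s0 - h" "k s = n" for s n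
    using that
  proof (induction n arbitrary: s)
    case 0
    then have "s < s0" using kS[of s] by fastforce
    then show ?case using init[of s] \<omega>_range[of s] 0 by simp
  next
    case (Suc n)
    then have "s \<ge> s0" using k0[of s] by force
    then have "\<alpha> s = \<sigma>_inv (\<alpha> (s - h))" "\<sigma> t0 \<le> \<alpha> (s - h)" using Suc kS[of s] step by auto
    then show ?case using \<sigma>_inv(1)[of "\<alpha> (s - h)"] \<sigma>_t0_less by linarith
  qed
  have "time_transformation t0 s0 h (\<lambda>t. t - \<sigma> t) \<omega> \<alpha>"
    unfolding time_transformation_iff using init step ge by simp
  then show ?thesis by blast
qed

section \<open>Regularity of the transformed time\<close>

context
  fixes \<alpha> :: "real \<Rightarrow> real"
  assumes \<alpha>: "time_transformation t0 s0 h (\<lambda>t. t - \<sigma> t) \<omega> \<alpha>"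
begin

lemma \<alpha>_initial: "s \<in> {s0 - h..s0} \<Longrightarrow> \<alpha> s = \<omega> s"
  using \<alpha> unfolding time_transformation_iff by blast

lemma \<alpha>_step:
  assumes "s \<ge> s0"
  shows "\<alpha> s = \<sigma>_inv (\<alpha> (s - h))" "\<alpha> (s - h) \<ge> \<sigma> t0" "\<alpha> s \<ge> t0" "\<sigma> (\<alpha> s) = \<alpha> (s - h)"
proof -
  show 1: "\<alpha> s = \<sigma>_inv (\<alpha> (s - h))" "\<alpha> (s - h) \<ge> \<sigma> t0"
    using \<alpha> assms unfolding time_transformation_iff by auto
  show "\<alpha> s \<ge> t0" "\<sigma> (\<alpha> s) = \<alpha> (s - h)"
    using \<sigma>_inv[OF 1(2)] by (auto simp: 1(1)[symmetric])
qed

text \<open>The numbering starts with the history interval \<open>J 0\<close>; interval number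
  \<open>k\<close> of \<open>constant_delay_solution\<close> is therefore
  \<open>J (Suc k)\<close>.\<close>

abbreviation J :: "nat \<Rightarrow> real set" where "J k \<equiv> {s0 - h + real k * h..s0 + real k * h}"

text \<open>The chain rule for \<open>\<alpha> s = \<sigma>_inv (\<alpha> (s - h))\<close> passes
  the derivative from \<open>J k\<close> to the next interval, divided by a positive value of
  \<open>\<sigma>'\<close>, so continuity and positivity persist. The function \<open>a\<close> is
  chosen separately for each \<open>k\<close>, since adjacent pieces may meet in a kink.\<close>

lemma \<alpha>_piecewise_C1:
  "\<exists>a. continuous_on (J k) a \<and> (\<forall>s\<in>J k. a s > 0 \<and> (\<alpha> has_real_derivative a s) (at s within J k))"
proof (induction k)
  case 0
  obtain w where w: "continuous_on {s0 - h..s0} w"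
    "\<And>s. s \<in> {s0 - h..s0} \<Longrightarrow> (\<omega> has_vector_derivative w s) (at s within {s0 - h..s0})"
    using \<omega>_C1 unfolding C1_on_def by blast
  \<comment> \<open>Admissibility provides a continuous derivative and a positive one in separate
    clauses; uniqueness of derivatives within a nondegenerate interval identifies them.\<close>
  have "w s > 0" if s: "s \<in> {s0 - h..s0}" for s
  proof -
    obtain d where d: "d > 0" "(\<omega> has_vector_derivative d) (at s within {s0 - h..s0})"
      using \<omega>_derivative[OF s] unfolding has_real_derivative_iff_has_vector_derivative by blast
    then have "w s = d"
      using vector_derivative_within_closed_interval[OF _ s w(2)[OF s]]
        vector_derivative_within_closed_interval[OF _ s d(2)] h_pos by simp
    with d show ?thesis by simp
  qed
  moreover have "(\<alpha> has_real_derivative w s) (at s within {s0 - h..s0})"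
    if s: "s \<in> {s0 - h..s0}" for s
    unfolding has_real_derivative_iff_has_vector_derivative
    by (rule has_vector_derivative_transform[OF s _ w(2)[OF s]]) (simp add: \<alpha>_initial)
  ultimately show ?case using w(1) by (intro exI[of _ w]) simp
next
  case (Suc k)
  then obtain a where a: "continuous_on (J k) a" "\<And>s. s \<in> J k \<Longrightarrow> a s > 0"
    "\<And>s. s \<in> J k \<Longrightarrow> (\<alpha> has_real_derivative a s) (at s within J k)" by blast
  have J: "s \<ge> s0" "s - h \<in> J k" if "s \<in> J (Suc k)" for s
  proof -
    have kh: "0 \<le> real k * h" using h_pos by simp
    have "s0 + real k * h \<le> s" "s \<le> s0 + real k * h + h" using that by (auto simp: algebra_simps)
    with kh show "s \<ge> s0" by linarith
    show "s - h \<in> J k" using that by (auto simp: algebra_simps)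
  qed
  define b where "b s = 1 / \<sigma>' (\<alpha> s) * a (s - h)" for s
  have \<sigma>'_pos: "\<sigma>' (\<alpha> s) > 0" if "s \<in> J (Suc k)" for s
    using \<sigma>'_ge[OF \<alpha>_step(3)[OF J(1)[OF that]]] c_pos by linarith
  have d: "(\<alpha> has_real_derivative b s) (at s within J (Suc k))" if s: "s \<in> J (Suc k)" for s
  proof -
    have "((\<lambda>s. s - h) has_real_derivative 1) (at s within J (Suc k))"
      by (auto intro!: derivative_eq_intros)
    moreover have "(\<alpha> has_real_derivative a (s - h)) (at (s - h) within (\<lambda>s. s - h) ` J (Suc k))"
      by (rule DERIV_subset[OF a(3)[OF J(2)[OF s]] image_subsetI[OF J(2)]])
    ultimately have sh: "((\<lambda>s. \<alpha> (s - h)) has_real_derivative a (s - h)) (at s within J (Suc k))"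
      using DERIV_image_chain[of \<alpha> _ "\<lambda>s. s - h"] by (fastforce simp: o_def)
    have "(\<sigma>_inv has_real_derivative 1 / \<sigma>' (\<alpha> s))
        (at (\<alpha> (s - h)) within (\<lambda>s. \<alpha> (s - h)) ` J (Suc k))"
      using \<sigma>_inv_derivative[OF \<alpha>_step(2)[OF J(1)[OF s]]]
      unfolding \<alpha>_step(1)[OF J(1)[OF s], symmetric]
      by (rule DERIV_subset) (use \<alpha>_step(2)[OF J(1)] in auto)
    from DERIV_image_chain[OF this sh]
    have "((\<lambda>s. \<sigma>_inv (\<alpha> (s - h))) has_real_derivative b s) (at s within J (Suc k))"
      unfolding o_def b_def .
    then show ?thesis unfolding has_real_derivative_iff_has_vector_derivative
      by (rule has_vector_derivative_transform[OF s, rotated]) (use \<alpha>_step(1)[OF J(1)] in auto)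
  qed
  have c\<alpha>: "continuous_on (J (Suc k)) \<alpha>" using d by (rule DERIV_continuous_on)
  have "continuous_on (J (Suc k)) (\<lambda>s. a (s - h))"
    by (intro continuous_on_compose2[OF a(1)] continuous_intros image_subsetI J(2))
  moreover have "continuous_on (J (Suc k)) (\<lambda>s. \<sigma>' (\<alpha> s))"
    by (rule continuous_on_compose2[OF \<sigma>'_continuous c\<alpha>]) (use \<alpha>_step(3)[OF J(1)] in auto)
  moreover have "\<forall>s\<in>J (Suc k). \<sigma>' (\<alpha> s) \<noteq> 0" using \<sigma>'_pos by (metis less_irrefl)
  ultimately have "continuous_on (J (Suc k)) b"
    unfolding b_def by (intro continuous_intros)
  moreover have "b s > 0" if "s \<in> J (Suc k)" for s
    using \<sigma>'_pos[OF that] a(2)[OF J(2)[OF that]] unfolding b_def by simp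
  ultimately show ?case using d by blast
qed

lemma \<alpha>_continuous: "continuous_on {s0 - h..} \<alpha>"
proof -
  have fin: "continuous_on {s0 - h..s0 + real k * h} \<alpha>" for k
  proof (induction k)
    case 0
    obtain a where "\<forall>s\<in>J 0. (\<alpha> has_real_derivative a s) (at s within J 0)"
      using \<alpha>_piecewise_C1 by blast
    then show ?case by (auto intro: DERIV_continuous_on)
  next
    case (Suc k)
    obtain a where "\<forall>s\<in>J (Suc k). (\<alpha> has_real_derivative a s) (at s within J (Suc k))"
      using \<alpha>_piecewise_C1 by blast
    then have "continuous_on (J (Suc k)) \<alpha>" by (auto intro: DERIV_continuous_on)
    with Suc have "continuous_on ({s0 - h..s0 + real k * h} \<union> J (Suc k)) \<alpha>"
      by (intro continuous_on_closed_Un) auto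
    moreover have kh: "s0 - h \<le> s0 + real k * h"
      using h_pos mult_nonneg_nonneg[of "real k" h] by linarith
    have "{s0 - h..s0 + real k * h} \<union> {s0 + real k * h..s0 + real k * h + h}
        = {s0 - h..s0 + real k * h + h}"
      by (rule ivl_disj_un_two_touch(4)[OF kh]) (use h_pos in simp)
    then have "{s0 - h..s0 + real k * h} \<union> J (Suc k) = {s0 - h..s0 + real (Suc k) * h}"
      by (simp add: algebra_simps)
    ultimately show ?case by simp
  qed
  show ?thesis unfolding continuous_on_eq_continuous_within
  proof
    fix s assume s: "s \<in> {s0 - h..}"
    obtain k :: nat where "(s - s0) / h < real k" using reals_Archimedean2 by blast
    then have k: "s < s0 + real k * h" using h_pos by (simp add: field_simps)
    have "continuous (at s within {s0 - h..s0 + real k * h}) \<alpha>"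
      using fin[of k] s k by (auto simp: continuous_on_eq_continuous_within)
    moreover have "at s within {s0 - h..s0 + real k * h} = at s within {s0 - h..}"
      by (rule at_within_nhd[of _ "{..<s0 + real k * h}"]) (use k in auto)
    ultimately show "continuous (at s within {s0 - h..}) \<alpha>" by simp
  qed
qed

text \<open>At a grid point the two pieces that meet there supply the one-sided derivatives; at
  \<open>s0\<close> the left one comes from \<omega>.\<close>

lemma \<alpha>_positive_derivative:
  assumes s: "s \<ge> s0"
  shows "positive_derivative_at s0 h \<alpha> s"
proof (cases "\<exists>k::nat. s = s0 + real k * h")
  case True
  then obtain k :: nat where k: "s = s0 + real k * h" by blast
  obtain a where a: "\<forall>s\<in>J k. a s > 0 \<and> (\<alpha> has_real_derivative a s) (at s within J k)"
    using \<alpha>_piecewise_C1 by blast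
  obtain b where b: "\<forall>s\<in>J (Suc k). b s > 0 \<and> (\<alpha> has_real_derivative b s) (at s within J (Suc k))"
    using \<alpha>_piecewise_C1 by blast
  have 1: "s \<in> J k" "at s within J k = at_left s"
    unfolding k using h_pos by (auto intro: at_within_Icc_at_left)
  have eq: "J (Suc k) = {s..s + h}" unfolding k by (simp add: algebra_simps)
  have 2: "s \<in> J (Suc k)" "at s within J (Suc k) = at_right s"
    unfolding eq using h_pos by (auto intro: at_within_Icc_at_right)
  show ?thesis unfolding positive_derivative_at_def using True a b 1 2 by metis
next
  case False
  define k where "k = nat \<lfloor>(s - s0) / h\<rfloor>"
  have "0 \<le> \<lfloor>(s - s0) / h\<rfloor>" using s h_pos by simp
  then have rk: "real k = of_int \<lfloor>(s - s0) / h\<rfloor>" unfolding k_def by simp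
  have "real k \<le> (s - s0) / h" "(s - s0) / h < real k + 1" unfolding rk by linarith+
  then have "s0 + real k * h \<le> s" "s < s0 + real (Suc k) * h" using h_pos by (auto simp: field_simps)
  moreover have "s \<noteq> s0 + real k * h" using False by blast
  ultimately have i: "s0 - h + real (Suc k) * h < s" "s < s0 + real (Suc k) * h"
    by (auto simp: algebra_simps)
  obtain b where b: "\<forall>s\<in>J (Suc k). b s > 0 \<and> (\<alpha> has_real_derivative b s) (at s within J (Suc k))"
    using \<alpha>_piecewise_C1 by blast
  have "\<exists>d>0. (\<alpha> has_real_derivative d) (at s)"
    using b i at_within_Icc_at[OF i] by (metis atLeastAtMost_iff less_imp_le)
  then show ?thesis unfolding positive_derivative_at_def using False by simp
qed

end

end

text \<open>Inserting \<open>\<sigma>1 (\<alpha>2 s)\<close> bounds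
  \<open>c * \<bar>\<alpha>1 s - \<alpha>2 s\<bar>\<close> by the error at \<open>s - h\<close> plus
  the difference of \<sigma>1 and \<sigma>2 at \<open>\<alpha>2 s\<close>. With \<open>c\<close> at
  most 1, both terms are at most \<open>\<epsilon> * (2 / c) ^ k\<close>, which explains the factor
  2. Because the two functions are compared only along \<alpha>2, it is \<alpha>2 that must stay
  below \<open>T\<close>.\<close>

lemma time_transformation_stability:
  fixes \<alpha>1 \<alpha>2 \<sigma>1 \<sigma>2 :: "real \<Rightarrow> real"
  assumes \<alpha>1: "\<And>s. s \<ge> s0 \<Longrightarrow> \<alpha>1 s \<ge> t0 \<and> \<sigma>1 (\<alpha>1 s) = \<alpha>1 (s - h)"
    and \<alpha>2: "\<And>s. s \<ge> s0 \<Longrightarrow> \<alpha>2 s \<ge> t0 \<and> \<sigma>2 (\<alpha>2 s) = \<alpha>2 (s - h)"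
    and expand: "\<And>a b. a \<ge> t0 \<Longrightarrow> b \<ge> t0 \<Longrightarrow> c * \<bar>a - b\<bar> \<le> \<bar>\<sigma>1 a - \<sigma>1 b\<bar>"
    and c: "0 < c" "c \<le> 1" and h: "h > 0"
    and init: "\<And>s. s \<in> {s0 - h..s0} \<Longrightarrow> \<bar>\<alpha>1 s - \<alpha>2 s\<bar> \<le> \<epsilon>"
    and \<sigma>: "\<And>t. t \<in> {t0..T} \<Longrightarrow> \<bar>\<sigma>1 t - \<sigma>2 t\<bar> \<le> \<epsilon>"
    and T: "\<And>s. s \<in> {s0..s0 + real k * h} \<Longrightarrow> \<alpha>2 s \<le> T"
    and s: "s \<in> {s0 - h..s0 + real k * h}"
  shows "\<bar>\<alpha>1 s - \<alpha>2 s\<bar> \<le> \<epsilon> * (2 / c) ^ k"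
  using T s
proof (induction k arbitrary: s)
  case (Suc k)
  have \<epsilon>0: "\<epsilon> \<ge> 0" using order_trans[OF abs_ge_zero init[of s0]] h by simp
  have p1: "1 \<le> (2 / c) ^ k" for k using c by (intro one_le_power) simp
  show ?case
  proof (cases "s \<le> s0")
    case True
    then have "\<bar>\<alpha>1 s - \<alpha>2 s\<bar> \<le> \<epsilon> * 1" using init[of s] Suc.prems by simp
    also have "\<dots> \<le> \<epsilon> * (2 / c) ^ Suc k" using p1 \<epsilon>0 by (rule mult_left_mono)
    finally show ?thesis .
  next
    case False
    then have ge: "s \<ge> s0" by simp
    have "s0 + real k * h \<le> s0 + real (Suc k) * h" using h by (simp add: algebra_simps)
    then have "\<bar>\<alpha>1 (s - h) - \<alpha>2 (s - h)\<bar> \<le> \<epsilon> * (2 / c) ^ k"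
      using Suc.prems ge by (intro Suc.IH) (auto simp: algebra_simps)
    moreover have "\<bar>\<sigma>1 (\<alpha>2 s) - \<sigma>2 (\<alpha>2 s)\<bar> \<le> \<epsilon>"
      using \<sigma>[of "\<alpha>2 s"] \<alpha>2[OF ge] Suc.prems ge by simp
    moreover have "c * \<bar>\<alpha>1 s - \<alpha>2 s\<bar> \<le> \<bar>\<sigma>1 (\<alpha>1 s) - \<sigma>1 (\<alpha>2 s)\<bar>"
      using expand[of "\<alpha>1 s" "\<alpha>2 s"] \<alpha>1[OF ge] \<alpha>2[OF ge] by simp
    moreover have "\<epsilon> \<le> \<epsilon> * (2 / c) ^ k" using mult_left_mono[OF p1 \<epsilon>0, of k] by simp
    ultimately have "c * \<bar>\<alpha>1 s - \<alpha>2 s\<bar> \<le> 2 * (\<epsilon> * (2 / c) ^ k)"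
      using \<alpha>1[OF ge] \<alpha>2[OF ge] by linarith
    then have "\<bar>\<alpha>1 s - \<alpha>2 s\<bar> \<le> 2 * (\<epsilon> * (2 / c) ^ k) / c" using c by (simp add: pos_le_divide_eq mult.commute)
    then show ?thesis by (simp add: mult.left_commute)
  qed
qed (use init in simp)
subsection \<open>The constant delay system\<close>

text \<open>The eventual pointwise bound serves twice: it bounds the supremum, and it gives the
  boundedness without which the supremum would not dominate its members.\<close>

lemma SUP_tendsto_zero:
  fixes F :: "nat \<Rightarrow> 'a \<Rightarrow> real"
  assumes "S \<noteq> {}" and nn: "\<And>n s. s \<in> S \<Longrightarrow> 0 \<le> F n s"
    and ev: "\<And>\<epsilon>. \<epsilon> > 0 \<Longrightarrow> eventually (\<lambda>n. \<forall>s\<in>S. F n s \<le> \<epsilon>) sequentially"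
  shows "(\<lambda>n. SUP s\<in>S. F n s) \<longlonglongrightarrow> 0"
proof (rule tendstoI)
  fix \<epsilon> :: real assume "\<epsilon> > 0"
  then have "eventually (\<lambda>n. \<forall>s\<in>S. F n s \<le> \<epsilon> / 2) sequentially" by (intro ev) simp
  then show "eventually (\<lambda>n. dist (SUP s\<in>S. F n s) 0 < \<epsilon>) sequentially"
  proof eventually_elim
    case (elim n)
    obtain s where s: "s \<in> S" using assms(1) by blast
    have "F n s \<le> (SUP s\<in>S. F n s)"
      using elim by (intro cSUP_upper s bdd_aboveI2[of _ _ "\<epsilon> / 2"]) auto
    moreover have "(SUP s\<in>S. F n s) \<le> \<epsilon> / 2" using elim assms(1) by (intro cSUP_least) auto
    ultimately show ?case using nn[OF s, of n] \<open>\<epsilon> > 0\<close> by simp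
  qed
qed

text \<open>A shift by \<open>h\<close> in \<open>s\<close> advances \<alpha> by a delay, hence by
  at most \<open>h\<close>. This gives one time horizon for all \<open>n\<close> on which the
  original solutions have to be compared.\<close>

lemma advance_at_most_delay_bound:
  fixes \<alpha> :: "real \<Rightarrow> real"
  assumes step: "\<And>s. s \<ge> s0 \<Longrightarrow> \<alpha> s \<le> \<alpha> (s - h) + h"
    and init: "\<And>s. s \<in> {s0 - h..s0} \<Longrightarrow> \<alpha> s \<le> t0" and "h > 0"
    and "s \<in> {s0 - h..s0 + real k * h}"
  shows "\<alpha> s \<le> t0 + real k * h"
  using assms(4)
proof (induction k arbitrary: s)
  case (Suc k)
  have kh: "0 \<le> real k * h" using \<open>h > 0\<close> by simp
  have eq: "real (Suc k) * h = real k * h + h" by (simp add: algebra_simps)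
  show ?case
  proof (cases "s \<le> s0")
    case True
    then have "\<alpha> s \<le> t0" using init[of s] Suc.prems by simp
    then show ?thesis unfolding eq using kh \<open>h > 0\<close> by linarith
  next
    case False
    then have "\<alpha> (s - h) \<le> t0 + real k * h" using Suc.prems unfolding eq by (intro Suc.IH) auto
    then show ?thesis unfolding eq using step[of s] False by linarith
  qed
qed (use init in simp)

context delay_system
begin

lemma time_change_global_solution:
  assumes s: "global_solution f G \<mu> etat h t0 g e0 y \<eta>" and e0: "e0 \<in> {0..h}"
    and \<omega>: "admissible_initial_time t0 s0 h e0 \<omega>"
  shows "time_change (\<lambda>t. t - \<eta> t) (\<lambda>t. 1 - (- \<mu> * (\<eta> t - etat) + G (y t))) \<omega> t0 s0 h
    (1 - 2 * (\<mu> * etat))"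
proof (rule time_change.intro)
  show "continuous_on {t0..} (\<lambda>t. 1 - (- \<mu> * (\<eta> t - etat) + G (y t)))"
    by (intro continuous_on_diff continuous_on_const global_solution_derivative(2)[OF s e0])
  have "\<eta> t0 = e0" using s unfolding global_solution_def by blast
  then show "\<omega> (s0 - h) = t0 - \<eta> t0" using \<omega> unfolding admissible_initial_time_def by simp
qed (use h_pos mu_etat_less \<omega> deviating_argument_derivative[OF s e0] in
    \<open>auto simp: admissible_initial_time_def\<close>)

context
  fixes g :: "real \<Rightarrow> real^'m" and e0 s0 :: real and y \<eta> \<omega> \<alpha>
  assumes s: "global_solution f G \<mu> etat h t0 g e0 y \<eta>" and e0: "e0 \<in> {0..h}"
    and \<omega>: "admissible_initial_time t0 s0 h e0 \<omega>"
    and \<alpha>: "time_transformation t0 s0 h \<eta> \<omega> \<alpha>"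
begin

interpretation tc: time_change "\<lambda>t. t - \<eta> t" "\<lambda>t. 1 - (- \<mu> * (\<eta> t - etat) + G (y t))" \<omega> t0 s0 h
    "1 - 2 * (\<mu> * etat)"
  by (rule time_change_global_solution[OF s e0 \<omega>])

lemma \<alpha>': "time_transformation t0 s0 h (\<lambda>t. t - (t - \<eta> t)) \<omega> \<alpha>"
  using \<alpha> by simp

lemma transformed_initial: "s \<in> {s0 - h..s0} \<Longrightarrow> \<alpha> s = \<omega> s \<and> \<alpha> s \<in> {t0 - h..t0}"
  using tc.\<alpha>_initial[OF \<alpha>'] tc.\<omega>_range s e0 unfolding global_solution_def by fastforce

lemma transformed_step:
  assumes "s \<ge> s0"
  shows "\<alpha> s \<ge> t0" "\<alpha> s - \<eta> (\<alpha> s) = \<alpha> (s - h)" "\<alpha> s \<le> \<alpha> (s - h) + h"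
proof -
  show 1: "\<alpha> s \<ge> t0" "\<alpha> s - \<eta> (\<alpha> s) = \<alpha> (s - h)" using tc.\<alpha>_step[OF \<alpha>' assms] by auto
  then show "\<alpha> s \<le> \<alpha> (s - h) + h" using global_solution_delay_range[OF s e0 1(1)] by auto
qed

lemma transformed_expands:
  "a \<ge> t0 \<Longrightarrow> b \<ge> t0 \<Longrightarrow> (1 - 2 * (\<mu> * etat)) * \<bar>a - b\<bar> \<le> \<bar>(a - \<eta> a) - (b - \<eta> b)\<bar>"
  by (rule tc.\<sigma>_expands_abs)

lemma transformed_positive_derivative: "s \<ge> s0 \<Longrightarrow> positive_derivative_at s0 h \<alpha> s"
  by (rule tc.\<alpha>_positive_derivative[OF \<alpha>'])

text \<open>The delay becomes constant because
  \<open>\<alpha> s - \<eta> (\<alpha> s) = \<alpha> (s - h)\<close>, so the delayed value of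
  \<open>y\<close> is \<open>z (s - h)\<close>. The equations are then the chain rule on each
  interval, where \<alpha> is continuously differentiable.\<close>

lemma transformed_constant_delay_solution:
  assumes z: "\<And>s. s \<ge> s0 - h \<Longrightarrow> z s = y (\<alpha> s)" and chi: "\<And>s. s \<ge> s0 \<Longrightarrow> chi s = \<eta> (\<alpha> s)"
  shows "constant_delay_solution f G \<mu> etat h s0 g e0 \<omega> z chi \<alpha>"
  unfolding constant_delay_solution_def Let_def
proof (intro conjI ballI allI impI)
  have cy: "continuous_on {t0 - h..} y" "continuous_on {t0..} \<eta>" and yg: "\<And>t. t \<in> {t0 - h..t0} \<Longrightarrow> y t = g t"
    using s unfolding global_solution_def by auto
  show c\<alpha>: "continuous_on {s0 - h..} \<alpha>" by (rule tc.\<alpha>_continuous[OF \<alpha>'])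
  have \<alpha>_range: "\<alpha> s \<in> {t0 - h..}" if "s \<ge> s0 - h" for s
    using transformed_initial[of s] transformed_step(1)[of s] that h_pos by (cases "s \<le> s0") auto
  have "continuous_on {s0 - h..} (\<lambda>s. y (\<alpha> s))"
    by (rule continuous_on_compose2[OF cy(1) c\<alpha>]) (use \<alpha>_range in auto)
  then show "continuous_on {s0 - h..} z" by (rule continuous_on_eq) (simp add: z)
  have "continuous_on {s0..} \<alpha>" using c\<alpha> by (rule continuous_on_subset) (use h_pos in auto)
  then have "continuous_on {s0..} (\<lambda>s. \<eta> (\<alpha> s))"
    by (rule continuous_on_compose2[OF cy(2)]) (use transformed_step(1) in auto)
  then show "continuous_on {s0..} chi" by (rule continuous_on_eq) (simp add: chi)
  show "z s = g (\<omega> s)" "\<alpha> s = \<omega> s" if "s \<in> {s0 - h..s0}" for s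
    using z[of s] yg[of "\<omega> s"] transformed_initial[OF that] that by auto
  have "\<alpha> s0 = t0" using transformed_initial[of s0] \<omega> h_pos by (auto simp: admissible_initial_time_def)
  then show "chi s0 = e0" using chi[of s0] s by (simp add: global_solution_def)
  show "\<alpha> s - chi s = \<alpha> (s - h)" if "s0 \<le> s" for s
    using transformed_step(2)[OF that] chi[OF that] by simp
  fix k :: nat
  let ?I = "{s0 + real k * h..s0 + (real k + 1) * h}"
  have eq: "{s0 - h + real (Suc k) * h..s0 + real (Suc k) * h} = ?I" by (simp add: algebra_simps)
  from tc.\<alpha>_piecewise_C1[OF \<alpha>', of "Suc k", unfolded eq] obtain a where
    a: "continuous_on ?I a" "\<And>s. s \<in> ?I \<Longrightarrow> (\<alpha> has_real_derivative a s) (at s within ?I)" by blast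
  have I: "s \<ge> s0" if "s \<in> ?I" for s
  proof -
    have "0 \<le> real k * h" "s0 + real k * h \<le> s" using that h_pos by simp_all
    then show ?thesis by linarith
  qed
  show "\<exists>\<alpha>'. continuous_on ?I \<alpha>' \<and>
          (\<forall>s\<in>?I. (\<alpha> has_real_derivative \<alpha>' s) (at s within ?I) \<and>
             (z has_vector_derivative \<alpha>' s *\<^sub>R f (\<alpha> s, z s, z (s - h))) (at s within ?I) \<and>
             (chi has_real_derivative - \<mu> * (chi s - etat) * \<alpha>' s + G (z s) * \<alpha>' s) (at s within ?I))"
  proof (intro exI[of _ a] conjI ballI)
    fix s assume sI: "s \<in> ?I"
    note s0s = I[OF sI]
    show "(\<alpha> has_real_derivative a s) (at s within ?I)" by (rule a(2)[OF sI])
    note \<alpha>d = this[unfolded has_real_derivative_iff_has_vector_derivative]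
    have sub: "\<alpha> ` ?I \<subseteq> {t0..}" using transformed_step(1)[OF I] by blast
    have zs: "z s = y (\<alpha> s)" "chi s = \<eta> (\<alpha> s)" "z (s - h) = y (\<alpha> s - \<eta> (\<alpha> s))"
      using z[of s] z[of "s - h"] chi[OF s0s] transformed_step(2)[OF s0s] s0s h_pos by auto
    note dy = has_vector_derivative_within_subset[OF
        global_solution_derivative(3)[OF s e0 transformed_step(1)[OF s0s]] sub]
    have "((\<lambda>s. y (\<alpha> s)) has_vector_derivative a s *\<^sub>R f (\<alpha> s, z s, z (s - h))) (at s within ?I)"
      using vector_diff_chain_within[OF \<alpha>d dy] unfolding zs o_def .
    then show "(z has_vector_derivative a s *\<^sub>R f (\<alpha> s, z s, z (s - h))) (at s within ?I)"
      by (rule has_vector_derivative_transform[OF sI, rotated])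
        (use z I h_pos in \<open>force\<close>)
    note d\<eta> = DERIV_subset[OF global_solution_derivative(4)[OF s e0 transformed_step(1)[OF s0s]] sub]
    have "((\<lambda>s. \<eta> (\<alpha> s)) has_real_derivative
        - \<mu> * (chi s - etat) * a s + G (z s) * a s) (at s within ?I)"
      using DERIV_image_chain[OF d\<eta> a(2)[OF sI]] unfolding zs o_def by (simp add: algebra_simps)
    then show "(chi has_real_derivative - \<mu> * (chi s - etat) * a s + G (z s) * a s) (at s within ?I)"
      unfolding has_real_derivative_iff_has_vector_derivative
      by (rule has_vector_derivative_transform[OF sI, rotated]) (use chi I in auto)
  qed (rule a(1))
qed

end

lemma time_transformation_global_solution_exists:
  assumes "global_solution f G \<mu> etat h t0 g e0 y \<eta>" "e0 \<in> {0..h}" "admissible_initial_time t0 s0 h e0 \<omega>"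
  shows "\<exists>\<alpha>. time_transformation t0 s0 h \<eta> \<omega> \<alpha>"
  using time_change.time_transformation_exists[OF time_change_global_solution[OF assms]] by simp

text \<open>The error of \<open>z\<close> is split at \<open>yb (\<alpha> n s)\<close>: closeness of
  the solutions at a common time, plus the Lipschitz constant of \<open>yb\<close> times the error
  of \<alpha>. The constants \<open>c\<close>, \<open>P\<close>, \<open>T\<close> and
  \<open>M\<close> do not depend on \<open>n\<close>.\<close>

lemma transformed_convergence:
  assumes sb: "global_solution f G \<mu> etat h t0 gb eb yb \<eta>b" and eb: "eb \<in> {0..h}"
    and \<omega>b: "admissible_initial_time t0 s0 h eb \<omega>b"
    and \<alpha>b: "time_transformation t0 s0 h \<eta>b \<omega>b \<alpha>b"
    and sn: "\<And>n. global_solution f G \<mu> etat h t0 (g n) (e n) (y n) (\<eta> n)" and en: "\<And>n. e n \<in> {0..h}"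
    and \<omega>n: "\<And>n. admissible_initial_time t0 s0 h (e n) (\<omega> n)"
    and \<alpha>n: "\<And>n. time_transformation t0 s0 h (\<eta> n) (\<omega> n) (\<alpha> n)"
    and gb: "C1_on {t0 - h..t0} gb"
    and \<delta>: "\<And>n t. t \<in> {t0 - h..t0} \<Longrightarrow> norm (g n t - gb t) \<le> \<delta> n" "\<And>n. \<bar>e n - eb\<bar> \<le> \<delta> n"
    and \<delta>0: "\<delta> \<longlonglongrightarrow> 0"
    and \<rho>: "\<And>n s. s \<in> {s0 - h..s0} \<Longrightarrow> \<bar>\<omega> n s - \<omega>b s\<bar> \<le> \<rho> n" and \<rho>0: "\<rho> \<longlonglongrightarrow> 0"
    and "S > 0"
  shows "(\<lambda>n. SUP s\<in>{s0..s0 + S}. norm (y n (\<alpha> n s) - yb (\<alpha>b s))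
    + \<bar>\<eta> n (\<alpha> n s) - \<eta>b (\<alpha>b s)\<bar> + \<bar>\<alpha> n s - \<alpha>b s\<bar>) \<longlonglongrightarrow> 0"
proof (rule SUP_tendsto_zero)
  fix \<epsilon>' :: real assume "\<epsilon>' > 0"
  obtain k :: nat where "S / h < real k" using reals_Archimedean2 by blast
  then have k: "S \<le> real k * h" using h_pos by (simp add: field_simps)
  define T where "T = t0 + real k * h"
  define c where "c = 1 - 2 * (\<mu> * etat)"
  define P where "P = (2 / c) ^ k"
  have c: "0 < c" "c \<le> 1" unfolding c_def using mu_etat_less mu_nonneg etat_pos by auto
  have P: "P > 0" unfolding P_def using c by simp
  obtain M where M: "M-lipschitz_on {t0 - h..T} yb" using global_solution_lipschitz[OF sb gb] by blast
  have M0: "M \<ge> 0" using M by (rule lipschitz_on_nonneg)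
  \<comment> \<open>The denominator collects \<open>1 + M * P\<close> from the \<open>y\<close>
    component, \<open>2 * P\<close> from the delay and \<open>P\<close> from \<alpha>.\<close>
  define \<epsilon> where "\<epsilon> = \<epsilon>' / (1 + M * P + 3 * P)"
  have den: "1 + M * P + 3 * P > 0" using P M0 by (simp add: add_pos_nonneg)
  then have \<epsilon>: "\<epsilon> > 0" unfolding \<epsilon>_def using \<open>\<epsilon>' > 0\<close> by simp
  have "eventually (\<lambda>n. \<rho> n < \<epsilon>) sequentially" using \<rho>0 \<epsilon> by (rule order_tendstoD(2))
  moreover have "eventually (\<lambda>n. (\<forall>t\<in>{t0 - h..T}. norm (y n t - yb t) \<le> \<epsilon>) \<and>
    (\<forall>t\<in>{t0..T}. \<bar>\<eta> n t - \<eta>b t\<bar> \<le> \<epsilon>)) sequentially"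
    by (rule global_solution_continuous_dependence[OF sb eb sn en gb \<delta> \<delta>0 \<epsilon>])
  ultimately show "eventually (\<lambda>n. \<forall>s\<in>{s0..s0 + S}. norm (y n (\<alpha> n s) - yb (\<alpha>b s))
    + \<bar>\<eta> n (\<alpha> n s) - \<eta>b (\<alpha>b s)\<bar> + \<bar>\<alpha> n s - \<alpha>b s\<bar> \<le> \<epsilon>') sequentially"
  proof eventually_elim
    case (elim n)
    note bi = transformed_initial[OF sb eb \<omega>b \<alpha>b] and ni = transformed_initial[OF sn en \<omega>n \<alpha>n]
    note bs = transformed_step[OF sb eb \<omega>b \<alpha>b] and ns = transformed_step[OF sn en \<omega>n \<alpha>n]
    have bi': "\<alpha>b s \<le> t0" if "s \<in> {s0 - h..s0}" for s
      using conjunct2[OF bi[OF that]] by simp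
    have ni': "\<alpha> n s \<le> t0" if "s \<in> {s0 - h..s0}" for s
      using conjunct2[OF ni[OF that]] by simp
    have bT: "\<alpha>b s \<le> T" if "s \<in> {s0 - h..s0 + real k * h}" for s
      unfolding T_def by (rule advance_at_most_delay_bound[where \<alpha>=\<alpha>b, OF bs(3) bi' h_pos that])
    have nT: "\<alpha> n s \<le> T" if "s \<in> {s0 - h..s0 + real k * h}" for s
      unfolding T_def by (rule advance_at_most_delay_bound[where \<alpha>="\<alpha> n", OF ns(3) ni' h_pos that])
    \<comment> \<open>Expansion is used for the perturbed argument \<open>t - \<eta> n t\<close>,
      whose constant \<open>c\<close> depends only on \<mu> and \<open>etat\<close>.\<close>
    have \<alpha>_close: "\<bar>\<alpha> n s - \<alpha>b s\<bar> \<le> \<epsilon> * P" if s: "s \<in> {s0 - h..s0 + real k * h}" for s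
      unfolding P_def
    proof (rule time_transformation_stability[where ?\<sigma>1.0 = "\<lambda>t. t - \<eta> n t" and ?\<sigma>2.0 = "\<lambda>t. t - \<eta>b t"
          and ?t0.0 = t0 and T = T, OF _ _ _ c h_pos _ _ _ s])
      show "\<alpha> n s \<ge> t0 \<and> \<alpha> n s - \<eta> n (\<alpha> n s) = \<alpha> n (s - h)" if "s \<ge> s0" for s using ns that by blast
      show "\<alpha>b s \<ge> t0 \<and> \<alpha>b s - \<eta>b (\<alpha>b s) = \<alpha>b (s - h)" if "s \<ge> s0" for s using bs that by blast
      show "c * \<bar>a - b\<bar> \<le> \<bar>a - \<eta> n a - (b - \<eta> n b)\<bar>" if "t0 \<le> a" "t0 \<le> b" for a b
        unfolding c_def by (rule transformed_expands[OF sn en \<omega>n \<alpha>n that])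
      show "\<bar>\<alpha> n s - \<alpha>b s\<bar> \<le> \<epsilon>" if "s \<in> {s0 - h..s0}" for s
        using ni[OF that] bi[OF that] \<rho>[OF that, of n] elim(1) by auto
      show "\<bar>t - \<eta> n t - (t - \<eta>b t)\<bar> \<le> \<epsilon>" if "t \<in> {t0..T}" for t
        using elim(2) that by (simp add: abs_minus_commute)
      show "\<alpha>b s \<le> T" if "s \<in> {s0..s0 + real k * h}" for s using bT[of s] that h_pos by simp
    qed
    show ?case
    proof
      fix s assume s: "s \<in> {s0..s0 + S}"
      then have s0s: "s \<ge> s0" and sk: "s \<in> {s0 - h..s0 + real k * h}" "s - h \<in> {s0 - h..s0 + real k * h}"
        using k h_pos by auto
      have r: "\<alpha> n s \<in> {t0 - h..T}" "\<alpha>b s \<in> {t0 - h..T}"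
        using ns(1)[OF s0s, of n] bs(1)[OF s0s] nT[OF sk(1)] bT[OF sk(1)] h_pos by auto
      have "norm (yb (\<alpha> n s) - yb (\<alpha>b s)) \<le> M * \<bar>\<alpha> n s - \<alpha>b s\<bar>"
        using lipschitz_on_normD[OF M r] by simp
      also have "\<dots> \<le> M * (\<epsilon> * P)" using \<alpha>_close[OF sk(1)] M0 by (rule mult_left_mono)
      finally have 1: "norm (yb (\<alpha> n s) - yb (\<alpha>b s)) \<le> M * (\<epsilon> * P)" .
      have 2: "norm (y n (\<alpha> n s) - yb (\<alpha> n s)) \<le> \<epsilon>" using elim(2) r(1) by blast
      have 3: "norm (y n (\<alpha> n s) - yb (\<alpha>b s)) \<le> \<epsilon> + M * (\<epsilon> * P)"
        using norm_triangle_ineq[of "y n (\<alpha> n s) - yb (\<alpha> n s)" "yb (\<alpha> n s) - yb (\<alpha>b s)"] 1 2 by simp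
      \<comment> \<open>Both delays are differences of \<alpha> at \<open>s\<close> and
        \<open>s - h\<close>, so two errors of \<alpha> suffice; this is why \<open>s - h\<close>
        was placed in the comparison interval.\<close>
      have 4: "\<bar>\<eta> n (\<alpha> n s) - \<eta>b (\<alpha>b s)\<bar> \<le> \<epsilon> * P + \<epsilon> * P"
        using ns(2)[OF s0s, of n] bs(2)[OF s0s] \<alpha>_close[OF sk(1)] \<alpha>_close[OF sk(2)] by linarith
      have "norm (y n (\<alpha> n s) - yb (\<alpha>b s)) + \<bar>\<eta> n (\<alpha> n s) - \<eta>b (\<alpha>b s)\<bar> + \<bar>\<alpha> n s - \<alpha>b s\<bar>
          \<le> (\<epsilon> + M * (\<epsilon> * P)) + (\<epsilon> * P + \<epsilon> * P) + \<epsilon> * P"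
        using 3 4 \<alpha>_close[OF sk(1)] by linarith
      also have "\<dots> = \<epsilon> * (1 + M * P + 3 * P)" by (simp add: algebra_simps)
      also have "\<dots> = \<epsilon>'" unfolding \<epsilon>_def using den by simp
      finally show "norm (y n (\<alpha> n s) - yb (\<alpha>b s)) + \<bar>\<eta> n (\<alpha> n s) - \<eta>b (\<alpha>b s)\<bar> + \<bar>\<alpha> n s - \<alpha>b s\<bar> \<le> \<epsilon>'" .
    qed
  qed
qed (use \<open>S > 0\<close> in auto)

end

theorem theorem1:
  fixes t0 s0 etat \<mu> h :: real
    and f :: "real \<times> (real^'m) \<times> (real^'m) \<Rightarrow> real^'m"
    and G :: "real^'m \<Rightarrow> real"
    and gb :: "real \<Rightarrow> real^'m" and \<eta>0b :: real and \<omega>b :: "real \<Rightarrow> real"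
    and g :: "nat \<Rightarrow> real \<Rightarrow> real^'m" and \<eta>0 :: "nat \<Rightarrow> real" and \<omega> :: "nat \<Rightarrow> real \<Rightarrow> real"
  assumes "etat > 0" and "h = 2 * etat"
    and "\<exists>L. L-lipschitz_on UNIV f" and "\<exists>L. L-lipschitz_on UNIV G"
    and "\<forall>x. \<bar>G x\<bar> \<le> \<mu> * etat" and "\<mu> * etat < 1/2"
    and "C1_on {t0 - h..t0} gb" and "\<eta>0b \<in> {0<..2 * etat}"
    and "\<forall>n. C1_on {t0 - h..t0} (g n)" and "\<forall>n. \<eta>0 n \<in> {0<..2 * etat}"
    and "(\<lambda>n. C1_norm (t0 - h) t0 (\<lambda>t. g n t - gb t) + \<bar>\<eta>0 n - \<eta>0b\<bar>) \<longlonglongrightarrow> 0"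
    and "admissible_initial_time t0 s0 h \<eta>0b \<omega>b"
    and "\<forall>n. admissible_initial_time t0 s0 h (\<eta>0 n) (\<omega> n)"
    and "(\<lambda>n. C1_norm (s0 - h) s0 (\<lambda>s. \<omega> n s - \<omega>b s)) \<longlonglongrightarrow> 0"
  shows "(\<exists>y \<eta>. global_solution f G \<mu> etat h t0 gb \<eta>0b y \<eta>) \<and>
    (\<forall>y \<eta>. global_solution f G \<mu> etat h t0 gb \<eta>0b y \<eta> \<longrightarrow>
       (\<exists>\<alpha>. time_transformation t0 s0 h \<eta> \<omega>b \<alpha>)) \<and>
    (\<forall>n. (\<exists>y \<eta>. global_solution f G \<mu> etat h t0 (g n) (\<eta>0 n) y \<eta>) \<and>
       (\<forall>y \<eta>. global_solution f G \<mu> etat h t0 (g n) (\<eta>0 n) y \<eta> \<longrightarrow>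
          (\<exists>\<alpha>. time_transformation t0 s0 h \<eta> (\<omega> n) \<alpha>))) \<and>
    (\<forall>zb chib \<alpha>b z chi \<alpha>.
       transformed_solution f G \<mu> etat h t0 s0 gb \<eta>0b \<omega>b zb chib \<alpha>b \<longrightarrow>
       (\<forall>n. transformed_solution f G \<mu> etat h t0 s0 (g n) (\<eta>0 n) (\<omega> n) (z n) (chi n) (\<alpha> n)) \<longrightarrow>
       constant_delay_solution f G \<mu> etat h s0 gb \<eta>0b \<omega>b zb chib \<alpha>b \<and>
       (\<forall>n. constant_delay_solution f G \<mu> etat h s0 (g n) (\<eta>0 n) (\<omega> n) (z n) (chi n) (\<alpha> n)) \<and>
       (\<forall>S>0.
          (\<lambda>n. SUP s\<in>{s0..s0 + S}.
             norm (z n s - zb s) + \<bar>chi n s - chib s\<bar> + \<bar>\<alpha> n s - \<alpha>b s\<bar>) \<longlonglongrightarrow> 0 \<and>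
          (\<forall>n. \<forall>s\<in>{s0..s0 + S}. positive_derivative_at s0 h (\<alpha> n) s)))"
proof -
  obtain Lf LG where "Lf-lipschitz_on UNIV f" "LG-lipschitz_on UNIV G" using assms(3,4) by blast
  then interpret delay_system f G \<mu> etat h t0 Lf LG
    by unfold_locales (use assms(1,2,5,6) in auto)
  have eb: "\<eta>0b \<in> {0..h}" and en: "\<eta>0 n \<in> {0..h}" for n
    using assms(2,8,10) by (auto simp: less_imp_le)
  have gn: "C1_on {t0 - h..t0} (g n)" and \<omega>n: "admissible_initial_time t0 s0 h (\<eta>0 n) (\<omega> n)" for n
    using assms(9,13) by auto
  define \<delta> where "\<delta> n = C1_norm (t0 - h) t0 (\<lambda>t. g n t - gb t) + \<bar>\<eta>0 n - \<eta>0b\<bar>" for n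
  define \<rho> where "\<rho> n = C1_norm (s0 - h) s0 (\<lambda>s. \<omega> n s - \<omega>b s)" for n
  have g_close: "norm (g n t - gb t) \<le> C1_norm (t0 - h) t0 (\<lambda>t. g n t - gb t)"
    if "t \<in> {t0 - h..t0}" for n t
    using norm_le_C1_norm[OF C1_on_diff[OF gn assms(7)] _ that] h_pos by simp
  have \<delta>: "norm (g n t - gb t) \<le> \<delta> n" if "t \<in> {t0 - h..t0}" for n t
    using g_close[OF that, of n] unfolding \<delta>_def by linarith
  \<comment> \<open>Dropping the \<open>C1_norm\<close> summand requires its nonnegativity, which
    follows from the pointwise bound at \<open>t0\<close>.\<close>
  have \<delta>': "\<bar>\<eta>0 n - \<eta>0b\<bar> \<le> \<delta> n" for n
    using order_trans[OF norm_ge_zero g_close[of t0 n]] h_pos unfolding \<delta>_def by simp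
  have \<delta>0: "\<delta> \<longlonglongrightarrow> 0" unfolding \<delta>_def using assms(11) .
  have \<rho>0: "\<rho> \<longlonglongrightarrow> 0" unfolding \<rho>_def using assms(14) .
  have \<omega>_C1: "C1_on {s0 - h..s0} (\<omega> n)" "C1_on {s0 - h..s0} \<omega>b" for n
    using \<omega>n[of n] assms(12) unfolding admissible_initial_time_def by auto
  have \<rho>: "\<bar>\<omega> n s - \<omega>b s\<bar> \<le> \<rho> n" if "s \<in> {s0 - h..s0}" for n s
    using norm_le_C1_norm[OF C1_on_diff[OF \<omega>_C1] _ that] h_pos unfolding \<rho>_def by simp
  have main: "constant_delay_solution f G \<mu> etat h s0 gb \<eta>0b \<omega>b zb chib \<alpha>b \<and>
       (\<forall>n. constant_delay_solution f G \<mu> etat h s0 (g n) (\<eta>0 n) (\<omega> n) (z n) (chi n) (\<alpha> n)) \<and>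
       (\<forall>S>0.
          (\<lambda>n. SUP s\<in>{s0..s0 + S}.
             norm (z n s - zb s) + \<bar>chi n s - chib s\<bar> + \<bar>\<alpha> n s - \<alpha>b s\<bar>) \<longlonglongrightarrow> 0 \<and>
          (\<forall>n. \<forall>s\<in>{s0..s0 + S}. positive_derivative_at s0 h (\<alpha> n) s))"
    if tb: "transformed_solution f G \<mu> etat h t0 s0 gb \<eta>0b \<omega>b zb chib \<alpha>b"
      and tn: "\<forall>n. transformed_solution f G \<mu> etat h t0 s0 (g n) (\<eta>0 n) (\<omega> n) (z n) (chi n) (\<alpha> n)"
    for zb chib \<alpha>b z chi \<alpha>
  proof -
    obtain yb \<eta>b where sb: "global_solution f G \<mu> etat h t0 gb \<eta>0b yb \<eta>b"
      and \<alpha>b: "time_transformation t0 s0 h \<eta>b \<omega>b \<alpha>b"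
      and zb: "\<And>s. s \<ge> s0 - h \<Longrightarrow> zb s = yb (\<alpha>b s)" "\<And>s. s \<ge> s0 \<Longrightarrow> chib s = \<eta>b (\<alpha>b s)"
      using tb unfolding transformed_solution_def by blast
    obtain y \<eta> where sn: "\<And>n. global_solution f G \<mu> etat h t0 (g n) (\<eta>0 n) (y n) (\<eta> n)"
      and \<alpha>n: "\<And>n. time_transformation t0 s0 h (\<eta> n) (\<omega> n) (\<alpha> n)"
      and zn: "\<And>n s. s \<ge> s0 - h \<Longrightarrow> z n s = y n (\<alpha> n s)"
        "\<And>n s. s \<ge> s0 \<Longrightarrow> chi n s = \<eta> n (\<alpha> n s)"
      using tn unfolding transformed_solution_def by metis
    have "(\<lambda>n. SUP s\<in>{s0..s0 + S}.
        norm (z n s - zb s) + \<bar>chi n s - chib s\<bar> + \<bar>\<alpha> n s - \<alpha>b s\<bar>) \<longlonglongrightarrow> 0" if "S > 0" for S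
    proof -
      have "(SUP s\<in>{s0..s0 + S}. norm (z n s - zb s) + \<bar>chi n s - chib s\<bar> + \<bar>\<alpha> n s - \<alpha>b s\<bar>)
        = (SUP s\<in>{s0..s0 + S}. norm (y n (\<alpha> n s) - yb (\<alpha>b s))
          + \<bar>\<eta> n (\<alpha> n s) - \<eta>b (\<alpha>b s)\<bar> + \<bar>\<alpha> n s - \<alpha>b s\<bar>)" for n
        using zb zn h_pos by (intro SUP_cong) auto
      then show ?thesis
        using transformed_convergence[OF sb eb assms(12) \<alpha>b sn en \<omega>n \<alpha>n assms(7) \<delta> \<delta>' \<delta>0 \<rho> \<rho>0 that]
        by simp
    qed
    moreover have "positive_derivative_at s0 h (\<alpha> n) s" if "s \<ge> s0" for n s
      by (rule transformed_positive_derivative[OF sn en \<omega>n \<alpha>n that])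
    ultimately show ?thesis
      using transformed_constant_delay_solution[OF sb eb assms(12) \<alpha>b zb]
        transformed_constant_delay_solution[OF sn en \<omega>n \<alpha>n zn] by simp
  qed
  show ?thesis
    using main global_solution_exists[OF assms(7) eb] global_solution_exists[OF gn en]
      time_transformation_global_solution_exists[OF _ eb assms(12)]
      time_transformation_global_solution_exists[OF _ en \<omega>n]
    by (intro conjI allI impI) blast+
qed

end
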